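(* Let $P$ be a $d$-dimensional lattice polytope, with $d\ge1$, possessing the integer decomposition property. If the coefficients of its $h^*$-polynomial satisfy $h_1^*(P)=h_d^*(P)$, then $P$ is a clean simplex, and its $h^*$-vector is unimodal.
   Context: A lattice $M$ is a free abelian group of finite rank, and $M_{\mathbb{R}}=M\otimes_{\mathbb{Z}}\mathbb{R}$. A lattice polytope $P\subset M_{\mathbb{R}}$ is the convex hull of a finite set of points of $M$; a $d$-dimensional lattice polytope with exactly $d+1$ vertices is a lattice simplex. The boundary of a polytope is taken relative to its affine span. Integer decomposition property (IDP): for every positive integer $n$, every $z\in nP\cap M$ can be written $z=z_1+\cdots+z_n$ with all $z_i\in P\cap M$. A positive-dimensional lattice simplex is clean if its only (relative) boundary lattice points are its vertices. $h^*$-polynomial and $h^*$-vector: $\sum_{n\ge 0}|nP\cap M|t^n=h^*_P(t)/(1-t)^{d+1}$ with $h_P^*(t)=\sum_{i=0}^d h_i^*(P)t^i$ and $d=\dim P$; the $h^*$-vector is $(h_0^*(P),\dots,h_d^*(P))$. A finite sequence $(a_0,\dots,a_d)$ is unimodal if there is $k$ with $a_0\le\cdots\le a_k\ge\cdots\ge a_d$. *)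

theory Defs
  imports
    "HOL-Analysis.Analysis"
    "HOL-Computational_Algebra.Formal_Power_Series"
begin

text \<open>
  The ambient type \<open>'a\<close> plays the role of \<open>M\<^sub>\<real>\<close>: a \<open>\<int>\<close>-basis of the free abelian group \<open>M\<close>
  is an \<open>\<real>\<close>-basis of \<open>M \<otimes> \<real>\<close>. The inner product on \<open>'a\<close> is unrelated to \<open>M\<close>.
\<close>

definition full_lattice :: "'a::euclidean_space set \<Rightarrow> bool" where
  "full_lattice M \<longleftrightarrow>
     (\<exists>B. finite B \<and> independent B \<and> span B = UNIV \<and>
          M = {\<Sum>b\<in>B. of_int (c b) *\<^sub>R b | c :: 'a \<Rightarrow> int. True})"

definition lattice_polytope :: "'a::euclidean_space set \<Rightarrow> 'a set \<Rightarrow> bool" where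
  "lattice_polytope M P \<longleftrightarrow> (\<exists>V. finite V \<and> V \<subseteq> M \<and> P = convex hull V)"

definition vertices :: "'a::euclidean_space set \<Rightarrow> 'a set" where
  "vertices P = {v. v extreme_point_of P}"

definition lattice_simplex :: "'a::euclidean_space set \<Rightarrow> 'a set \<Rightarrow> bool" where
  "lattice_simplex M P \<longleftrightarrow> lattice_polytope M P \<and> int (card (vertices P)) = aff_dim P + 1"

definition clean_simplex :: "'a::euclidean_space set \<Rightarrow> 'a set \<Rightarrow> bool" where
  "clean_simplex M P \<longleftrightarrow>
     lattice_simplex M P \<and> aff_dim P > 0 \<and> rel_frontier P \<inter> M = vertices P"

definition dilate :: "nat \<Rightarrow> 'a::euclidean_space set \<Rightarrow> 'a set" where
  "dilate n P = (\<lambda>x. real n *\<^sub>R x) ` P"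

definition IDP :: "'a::euclidean_space set \<Rightarrow> 'a set \<Rightarrow> bool" where
  "IDP M P \<longleftrightarrow>
     (\<forall>n>0. \<forall>z \<in> dilate n P \<inter> M.
        \<exists>y :: nat \<Rightarrow> 'a. (\<forall>i<n. y i \<in> P \<inter> M) \<and> z = (\<Sum>i<n. y i))"

definition ehrhart_series :: "'a::euclidean_space set \<Rightarrow> 'a set \<Rightarrow> int fps" where
  "ehrhart_series M P = Abs_fps (\<lambda>n. int (card (dilate n P \<inter> M)))"

text \<open>
  The defining equation \<open>\<Sum>\<^sub>n |nP \<inter> M| t\<^sup>n = h\<^sup>*(t) / (1 - t)\<^sup>d\<^sup>+\<^sup>1\<close>, solved for \<open>h\<^sup>*\<close> in the ring
  of formal power series, where \<open>1 - t\<close> is a unit. For a nonempty lattice polytope, this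
  series is a polynomial of degree at most \<open>d = dim P\<close> (theorems of Ehrhart and Stanley); since
  only its coefficients are used, that theorem is not built into the definition.
\<close>

definition hstar :: "'a::euclidean_space set \<Rightarrow> 'a set \<Rightarrow> int fps" where
  "hstar M P = ehrhart_series M P * (1 - fps_X) ^ (nat (aff_dim P) + 1)"

definition hstar_coeff :: "'a::euclidean_space set \<Rightarrow> 'a set \<Rightarrow> nat \<Rightarrow> int" where
  "hstar_coeff M P i = fps_nth (hstar M P) i"

definition unimodal_upto :: "nat \<Rightarrow> (nat \<Rightarrow> int) \<Rightarrow> bool" where
  "unimodal_upto d a \<longleftrightarrow> (\<exists>k\<le>d. mono_on {0..k} a \<and> antimono_on {k..d} a)"

end

theory Submission
  imports Defs "HOL-Library.Poly_Mapping" "HOL-Library.Z2"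
begin

text \<open>
  Cleanness: a regular triangulation of \<open>P\<close> from generic weights, made half-open by pushing
  points in a generic direction \<open>q\<close>, writes \<open>h\<^sup>*\<^sub>i\<close> as the number of box points of height
  \<open>i\<close>. Reflecting the top boxes and pushing in direction \<open>-q\<close> embeds the points counted by
  \<open>h\<^sup>*\<^sub>d\<close> into the interior lattice points of \<open>P\<close>. Since \<open>h\<^sup>*\<^sub>1 = |P \<inter> M| - d - 1\<close>, the
  hypothesis leaves at most \<open>d + 1\<close> boundary lattice points, and \<open>P\<close> has at least that many vertices.

  Unimodality: for a clean IDP simplex every nonzero box point is interior and is a sum of box
  points of height 1, so \<open>x \<mapsto> (1,\<dots>,1) - x\<close> gives \<open>h\<^sup>*\<^sub>i = h\<^sup>*\<^sub>d\<^sub>+\<^sub>1\<^sub>-\<^sub>i\<close>. The growth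
  \<open>h\<^sup>*\<^sub>i \<le> h\<^sup>*\<^sub>i\<^sub>+\<^sub>1\<close> for \<open>2i \<le> d\<close> is an anisotropy argument in characteristic 2, in the spirit of
  Adiprasito, Papadakis and Petrotou. The vertices are perturbed to a generic system of parameters
  \<open>\<theta>\<close> over \<open>F\<^sub>2[X][[\<tau>]]\<close>. If multiplication by a generic linear form \<open>\<ell>\<close> had a kernel
  element \<open>u\<close> in degree \<open>i\<close>, then \<open>deg (u\<^sup>2 \<ell> w) = 0\<close> for all monomials \<open>w\<close>; by the Frobenius
  identity for \<open>deg\<close> this is a combination of squares \<open>deg (u z)\<^sup>2\<close> whose coefficients are distinct
  squarefree monomials in \<open>X\<close>, so every \<open>deg (u z)\<close> vanishes and \<open>u = 0\<close>.
\<close>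

section \<open>Algebra in characteristic 2\<close>

unbundle no vec_syntax
unbundle fps_syntax

abbreviation lookup :: "('k \<Rightarrow>\<^sub>0 'r::zero) \<Rightarrow> 'k \<Rightarrow> 'r" where
  "lookup \<equiv> Poly_Mapping.lookup"

abbreviation keys :: "('k \<Rightarrow>\<^sub>0 'r::zero) \<Rightarrow> 'k set" where
  "keys \<equiv> Poly_Mapping.keys"

lemma sum_square_char2:
  fixes f :: "'a \<Rightarrow> 'r::comm_ring_1"
  assumes two: "(1::'r) + 1 = 0" and "finite A"
  shows "(\<Sum>a\<in>A. f a)^2 = (\<Sum>a\<in>A. (f a)^2)"
  using assms(2)
proof (induction A)
  case (insert a A)
  have "(2::'r) = 0" using two by (metis one_add_one)
  then show ?case using insert by (simp add: power2_sum)
qed simp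

text \<open>Coefficient \<open>n\<close> sees only the truncation \<open>G\<close> of
  \<open>F\<close> at degree \<open>n\<close>, and \<open>G\<close> is a finite sum of monomials, to
  which \<open>sum_square_char2\<close> applies.\<close>

lemma fps_square_nth_char2:
  fixes F :: "'r::comm_ring_1 fps"
  assumes two: "(1::'r) + 1 = 0"
  shows "(F^2) $ n = (if even n then (F $ (n div 2))^2 else 0)"
proof -
  define G where "G = (\<Sum>i\<le>n. fps_const (F $ i) * fps_X ^ i)"
  have G: "G $ k = F $ k" if "k \<le> n" for k
  proof -
    have "G $ k = (\<Sum>i\<le>n. if k = i then F $ i else 0)"
      unfolding G_def fps_sum_nth by (intro sum.cong) (auto simp: fps_X_power_nth)
    then show ?thesis using that by simp
  qed
  have two': "(1::'r fps) + 1 = 0"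
    using two by (metis fps_const_0_eq_0 fps_const_1_eq_1 fps_const_add)
  have "(F^2) $ n = (G^2) $ n"
    unfolding power2_eq_square fps_mult_nth by (intro sum.cong) (auto simp: G)
  also have "G^2 = (\<Sum>i\<le>n. (fps_const (F $ i) * fps_X ^ i)^2)"
    unfolding G_def by (rule sum_square_char2[OF two']) simp
  also have "\<dots> = (\<Sum>i\<le>n. fps_const ((F $ i)^2) * fps_X ^ (2*i))"
    by (intro sum.cong) (auto simp: power_mult_distrib power_mult[symmetric] mult.commute)
  also have "\<dots> $ n = (\<Sum>i\<le>n. if n = 2 * i then (F $ i)^2 else 0)"
    unfolding fps_sum_nth by (intro sum.cong) (auto simp: fps_X_power_nth)
  also have "\<dots> = (if even n then (F $ (n div 2))^2 else 0)"
  proof (cases "even n")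
    case True
    then have "(n = 2 * i) = (i = n div 2)" for i by auto
    then show ?thesis using True by simp
  next
    case False
    then have "n \<noteq> 2 * i" for i by auto
    then show ?thesis using False by simp
  qed
  finally show ?thesis .
qed

section \<open>Squares in monoid algebras of characteristic 2\<close>

lemma poly_mapping_monomials:
  "f = (\<Sum>k\<in>keys f. Poly_Mapping.single k (lookup f k))"
proof (rule poly_mapping_eqI)
  fix k
  have "lookup (\<Sum>k\<in>keys f. Poly_Mapping.single k (lookup f k)) k
     = (\<Sum>k'\<in>keys f. if k' = k then lookup f k' else 0)"
    unfolding lookup_sum by (intro sum.cong) (auto simp: lookup_single when_def)
  also have "\<dots> = lookup f k" by (simp add: in_keys_iff)
  finally show "lookup f k = lookup (\<Sum>k\<in>keys f. Poly_Mapping.single k (lookup f k)) k" by simp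
qed

lemma poly_mapping_two:
  assumes "(1::'r::comm_ring_1) + 1 = 0"
  shows "(1::'k::comm_monoid_add \<Rightarrow>\<^sub>0 'r) + 1 = 0"
  using assms by (metis single_add single_one single_zero)

lemma poly_mapping_square_char2:
  fixes f :: "'k::comm_monoid_add \<Rightarrow>\<^sub>0 'r::comm_ring_1"
  assumes two: "(1::'r) + 1 = 0"
  shows "f^2 = (\<Sum>k\<in>keys f. Poly_Mapping.single (k + k) ((lookup f k)^2))"
proof -
  have "f^2 = (\<Sum>k\<in>keys f. Poly_Mapping.single k (lookup f k))^2"
    by (simp only: poly_mapping_monomials[symmetric])
  also have "\<dots> = (\<Sum>k\<in>keys f. (Poly_Mapping.single k (lookup f k))^2)"
    by (rule sum_square_char2[OF poly_mapping_two[OF two]]) simp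
  finally show ?thesis by (simp add: power2_eq_square mult_single)
qed

lemma lookup_single_mult:
  fixes f :: "'k::cancel_comm_monoid_add \<Rightarrow>\<^sub>0 'r::comm_ring_1"
  shows "lookup (Poly_Mapping.single k r * f) (k + l) = r * lookup f l"
proof -
  have "Poly_Mapping.single k r * f
     = (\<Sum>i\<in>keys f. Poly_Mapping.single (k + i) (r * lookup f i))"
  proof -
    have "Poly_Mapping.single k r * f
       = Poly_Mapping.single k r * (\<Sum>i\<in>keys f. Poly_Mapping.single i (lookup f i))"
      by (simp only: poly_mapping_monomials[symmetric])
    then show ?thesis by (simp add: sum_distrib_left mult_single)
  qed
  then have "lookup (Poly_Mapping.single k r * f) (k + l)
     = (\<Sum>i\<in>keys f. if i = l then r * lookup f i else 0)"
    by (auto simp: lookup_sum lookup_single when_def intro!: sum.cong)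
  then show ?thesis by (simp add: in_keys_iff)
qed

text \<open>Squaring doubles exponents, and in a real vector space every exponent has exactly one
  half, so no parity condition as in \<open>fps_square_nth_char2\<close> arises.\<close>

lemma lookup_square_char2:
  fixes f :: "'k::real_vector \<Rightarrow>\<^sub>0 'r::comm_ring_1"
  assumes two: "(1::'r) + 1 = 0"
  shows "lookup (f^2) y = (lookup f (y /\<^sub>R 2))^2"
proof -
  have eq: "(k + k = y) = (k = y /\<^sub>R 2)" for k
  proof -
    have "k + k = 2 *\<^sub>R k" by (simp add: scaleR_2)
    then show ?thesis by auto
  qed
  have "lookup (f^2) y = (\<Sum>k\<in>keys f. if k = y /\<^sub>R 2 then (lookup f k)^2 else 0)"
    unfolding poly_mapping_square_char2[OF two] lookup_sum
    by (intro sum.cong) (auto simp: lookup_single when_def eq)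
  then show ?thesis by (simp add: in_keys_iff)
qed

text \<open>
  Polynomials over the two-element field in countably many variables, which are coded by naturals
  because the \<open>idom\<close> instance of \<open>Poly_Mapping\<close> needs a linear order on the exponents.
\<close>

type_synonym bpoly = "(nat \<Rightarrow>\<^sub>0 nat) \<Rightarrow>\<^sub>0 bit"

lemma bit_two: "(1::bit) + 1 = 0"
  by simp

lemma bpoly_two: "(1::bpoly) + 1 = 0"
  by (rule poly_mapping_two) (rule bit_two)

lemma bit_square [simp]: "(b::bit)^2 = b"
  by (cases b) auto

text \<open>Squares over the two-element field have only even exponents, so distinct squarefree
  monomials are independent over the subring of squares: the parity of an exponent tells which
  \<open>\<epsilon> a\<close> it came from.\<close>

lemma bpoly_squarefree_independent:
  fixes r :: "'i \<Rightarrow> bpoly" and \<epsilon> :: "'i \<Rightarrow> (nat \<Rightarrow>\<^sub>0 nat)"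
  assumes "finite A" and inj: "inj_on \<epsilon> A" and sqf: "\<And>a k. a \<in> A \<Longrightarrow> lookup (\<epsilon> a) k \<le> 1"
    and zero: "(\<Sum>a\<in>A. Poly_Mapping.single (\<epsilon> a) 1 * (r a)^2) = 0" and "b \<in> A"
  shows "r b = 0"
proof (rule poly_mapping_eqI)
  fix m
  \<comment> \<open>Reducing exponents modulo 2 recovers \<open>\<epsilon>\<close>, and halving what
    remains recovers \<open>k\<close>.\<close>
  have key: "a = b \<and> k = m" if "a \<in> A" and e: "\<epsilon> a + (k + k) = \<epsilon> b + (m + m)" for a k
  proof -
    have l: "lookup (\<epsilon> a) x + 2 * lookup k x = lookup (\<epsilon> b) x + 2 * lookup m x" for x
      using arg_cong[OF e, of "\<lambda>p. lookup p x"] by (simp add: lookup_add)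
    have le: "lookup (\<epsilon> a) x \<le> 1" "lookup (\<epsilon> b) x \<le> 1" for x
      using sqf that \<open>b \<in> A\<close> by auto
    have "lookup (\<epsilon> a) x = lookup (\<epsilon> b) x \<and> lookup k x = lookup m x" for x
      using l[of x] le[of x] by presburger
    then have "\<epsilon> a = \<epsilon> b" "k = m" by (auto intro: poly_mapping_eqI)
    then show ?thesis using inj that \<open>b \<in> A\<close> by (auto dest: inj_onD)
  qed
  have c: "lookup (Poly_Mapping.single (\<epsilon> a) 1 * (r a)^2) (\<epsilon> b + (m + m)) =
      (if a = b then lookup (r b) m else 0)" if "a \<in> A" for a
  proof -
    have "Poly_Mapping.single (\<epsilon> a) 1 * (r a)^2
       = (\<Sum>k\<in>keys (r a). Poly_Mapping.single (\<epsilon> a + (k + k)) (lookup (r a) k))"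
      unfolding poly_mapping_square_char2[OF bit_two]
      by (simp only: sum_distrib_left mult_single bit_square mult_1_left)
    then have "lookup (Poly_Mapping.single (\<epsilon> a) 1 * (r a)^2) (\<epsilon> b + (m + m)) =
       (\<Sum>k\<in>keys (r a). if \<epsilon> a + (k + k) = \<epsilon> b + (m + m) then lookup (r a) k else 0)"
      by (auto simp: lookup_sum lookup_single when_def intro!: sum.cong)
    also have "\<dots> = (\<Sum>k\<in>keys (r a). if k = m then (if a = b then lookup (r b) m else 0) else 0)"
    proof (intro sum.cong refl)
      fix k
      show "(if \<epsilon> a + (k + k) = \<epsilon> b + (m + m) then lookup (r a) k else 0)
        = (if k = m then if a = b then lookup (r b) m else 0 else 0)"
        using key[OF that, of k] by (cases "\<epsilon> a + (k + k) = \<epsilon> b + (m + m)") auto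
    qed
    also have "\<dots> = (if a = b then lookup (r b) m else 0)"
      by (auto simp: in_keys_iff simp del: bit_not_zero_iff)
    finally show ?thesis .
  qed
  have "0 = (\<Sum>a\<in>A. lookup (Poly_Mapping.single (\<epsilon> a) 1 * (r a)^2) (\<epsilon> b + (m + m)))"
    using arg_cong[OF zero, of "\<lambda>p. lookup p (\<epsilon> b + (m + m))"] by (simp add: lookup_sum)
  also have "\<dots> = lookup (r b) m"
    using assms(1,5) by (simp add: c cong: sum.cong)
  finally show "lookup (r b) m = lookup 0 m" by simp
qed

lemma bpoly_fps_squarefree_independent:
  fixes p :: "'i \<Rightarrow> bpoly fps" and \<epsilon> :: "'i \<Rightarrow> (nat \<Rightarrow>\<^sub>0 nat)" and k :: "'i \<Rightarrow> nat"
  assumes A: "finite A" "inj_on \<epsilon> A" "\<And>a k. a \<in> A \<Longrightarrow> lookup (\<epsilon> a) k \<le> 1"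
    and zero: "(\<Sum>a\<in>A. fps_const (Poly_Mapping.single (\<epsilon> a) 1) * fps_X ^ k a * (p a)^2) = 0"
    and b: "b \<in> A"
  shows "p b = 0"
proof (rule fps_ext)
  fix m
  \<comment> \<open>The degree in which the square of the \<open>m\<close>-th coefficient of
    \<open>p b\<close> appears.\<close>
  define n where "n = k b + 2 * m"
  \<comment> \<open>The coefficient of \<open>p a\<close> whose square lands in degree
    \<open>n\<close> after the shift by \<open>k a\<close>; 0 if \<open>k a\<close> exceeds
    \<open>n\<close> or the parity is wrong.\<close>
  define r where "r a = (if k a \<le> n \<and> even (n - k a) then p a $ ((n - k a) div 2) else 0)" for a
  have "(fps_const (Poly_Mapping.single (\<epsilon> a) 1) * fps_X ^ k a * (p a)^2) $ n
     = Poly_Mapping.single (\<epsilon> a) 1 * (r a)^2" for a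
    by (simp add: r_def mult.assoc fps_X_power_mult_nth fps_square_nth_char2[OF bpoly_two])
  then have "(\<Sum>a\<in>A. Poly_Mapping.single (\<epsilon> a) 1 * (r a)^2) = 0"
    using arg_cong[OF zero, of "\<lambda>f. f $ n"] by (simp add: fps_sum_nth)
  from bpoly_squarefree_independent[OF A this b] have "r b = 0" .
  then show "p b $ m = 0 $ m" by (simp add: r_def n_def)
qed

section \<open>Linear algebra over domains\<close>

text \<open>Gaussian elimination without division: rows are multiplied by the pivot instead of being
  divided by it.\<close>

lemma underdetermined_system:
  fixes a :: "'y \<Rightarrow> 'x \<Rightarrow> 'r::idom"
  assumes "finite Y" "finite X" "card Y < card X"
  shows "\<exists>u. (\<exists>x\<in>X. u x \<noteq> 0) \<and> (\<forall>y\<in>Y. (\<Sum>x\<in>X. a y x * u x) = 0)"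
  using assms
proof (induction Y arbitrary: X a rule: finite_induct)
  case empty
  then obtain x where "x \<in> X" by fastforce
  then show ?case by (intro exI[of _ "\<lambda>_. 1"]) auto
next
  case (insert y Y)
  show ?case
  proof (cases "\<forall>x\<in>X. a y x = 0")
    case True
    have "card Y < card X" using insert by simp
    from insert.IH[OF insert.prems(1) this, of a] True show ?thesis by auto
  next
    case False
    then obtain k where k: "k \<in> X" "a y k \<noteq> 0" by auto
    define X' where "X' = X - {k}"
    have X: "X = insert k X'" "k \<notin> X'" "finite X'" using k insert.prems X'_def by auto
    have "card Y < card X'" using insert X by simp
    from insert.IH[OF X(3) this, of "\<lambda>z x. a y k * a z x - a z k * a y x"]
    obtain u where u: "\<exists>x\<in>X'. u x \<noteq> 0"
      "\<forall>z\<in>Y. (\<Sum>x\<in>X'. (a y k * a z x - a z k * a y x) * u x) = 0" by auto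
    \<comment> \<open>The reduced solution is scaled by the pivot \<open>a y k\<close>, so that row
      \<open>y\<close> can be solved for the entry at \<open>k\<close> without a quotient.\<close>
    define v where "v x = (if x = k then - (\<Sum>x\<in>X'. a y x * u x) else a y k * u x)" for x
    have v: "(\<Sum>x\<in>X. a z x * v x)
       = (\<Sum>x\<in>X'. (a y k * a z x - a z k * a y x) * u x)" for z
    proof -
      have "(\<Sum>x\<in>X'. a z x * v x) = (\<Sum>x\<in>X'. a z x * (a y k * u x))"
        by (intro sum.cong) (use X(2) in \<open>auto simp: v_def\<close>)
      moreover have "a z k * v k = - (\<Sum>x\<in>X'. a z k * (a y x * u x))"
        by (simp add: v_def sum_distrib_left)
      ultimately show ?thesis
        using X by (simp add: sum_subtractf[symmetric] algebra_simps)
    qed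
    have "\<exists>x\<in>X. v x \<noteq> 0" using u(1) k(2) X by (auto simp: v_def)
    moreover have "(\<Sum>x\<in>X. a z x * v x) = 0" if "z \<in> insert y Y" for z
      using that u(2) unfolding v by auto
    ultimately show ?thesis by blast
  qed
qed

text \<open>Off the diagonal the terms come in equal pairs, which cancel.\<close>

lemma sum_symmetric_char2:
  fixes F :: "'x \<Rightarrow> 'x \<Rightarrow> 'r::comm_ring_1"
  assumes two: "(1::'r) + 1 = 0" and "finite A" and sym: "\<And>x y. F x y = F y x"
  shows "(\<Sum>x\<in>A. \<Sum>y\<in>A. F x y) = (\<Sum>x\<in>A. F x x)"
  using assms(2)
proof (induction A)
  case (insert a A)
  have "r + r = 0" for r :: 'r
    using two by (metis distrib_left mult.right_neutral mult_zero_right)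
  then have z: "r + (r + q) = q" for r q :: 'r
    by (simp add: add.assoc[symmetric])
  have "(\<Sum>x\<in>A. F x a) = (\<Sum>y\<in>A. F a y)"
    using sym by simp
  then show ?case using insert by (simp add: sum.distrib z algebra_simps)
qed simp

section \<open>Half-open simplicial cones\<close>

text \<open>\<open>E\<close> generates a simplicial cone, and \<open>L\<close> is a lattice in its
  span that may be finer than the one generated by \<open>E\<close>; the box points measure the
  difference.\<close>

locale simplicial_lattice =
  fixes E :: "'c::euclidean_space set" and L :: "'c set"
  assumes indep: "independent E" and E_L: "E \<subseteq> L" and L_span: "L \<subseteq> span E"
    and L_zero: "0 \<in> L"
    and L_add: "\<And>x y. x \<in> L \<Longrightarrow> y \<in> L \<Longrightarrow> x + y \<in> L"
    and L_diff: "\<And>x y. x \<in> L \<Longrightarrow> y \<in> L \<Longrightarrow> x - y \<in> L"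
    and L_discrete: "\<And>S. bounded S \<Longrightarrow> finite (L \<inter> S)"
begin

definition coord :: "'c \<Rightarrow> 'c \<Rightarrow> real" where "coord x e = representation E x e"

definition hgt :: "'c \<Rightarrow> real" where "hgt x = (\<Sum>e\<in>E. coord x e)"

lemma finite_E: "finite E"
  using indep by (rule independent_imp_finite)

lemma in_span: "x \<in> L \<Longrightarrow> x \<in> span E"
  using L_span by auto

lemma coord_add: "x \<in> L \<Longrightarrow> y \<in> L \<Longrightarrow> coord (x + y) e = coord x e + coord y e"
  by (simp add: coord_def representation_add[OF indep] in_span)

lemma coord_diff: "x \<in> L \<Longrightarrow> y \<in> L \<Longrightarrow> coord (x - y) e = coord x e - coord y e"
  by (simp add: coord_def representation_diff[OF indep] in_span)

lemma coord_zero [simp]: "coord 0 e = 0"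
  by (simp add: coord_def representation_zero)

lemma coord_basis: "e \<in> E \<Longrightarrow> coord e f = (if f = e then 1 else 0)"
  by (simp add: coord_def representation_basis[OF indep])

lemma L_sum: "(\<And>i. i \<in> A \<Longrightarrow> f i \<in> L) \<Longrightarrow> sum f A \<in> L"
  by (induction A rule: infinite_finite_induct) (auto intro: L_zero L_add)

lemma coord_sum: "(\<And>i. i \<in> A \<Longrightarrow> f i \<in> L) \<Longrightarrow> coord (sum f A) e = (\<Sum>i\<in>A. coord (f i) e)"
  by (induction A rule: infinite_finite_induct) (auto simp: coord_add L_sum)

lemma expand: "x \<in> L \<Longrightarrow> (\<Sum>e\<in>E. coord x e *\<^sub>R e) = x"
  unfolding coord_def by (rule sum_representation_eq[OF indep]) (auto simp: in_span finite_E)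

lemma hgt_add: "x \<in> L \<Longrightarrow> y \<in> L \<Longrightarrow> hgt (x + y) = hgt x + hgt y"
  by (simp add: hgt_def coord_add sum.distrib)

lemma hgt_diff: "x \<in> L \<Longrightarrow> y \<in> L \<Longrightarrow> hgt (x - y) = hgt x - hgt y"
  by (simp add: hgt_def coord_diff sum_subtractf)

lemma hgt_basis: "e \<in> E \<Longrightarrow> hgt e = 1"
  by (simp add: hgt_def coord_basis finite_E)

lemma hgt_zero [simp]: "hgt 0 = 0"
  by (simp add: hgt_def)

lemma hgt_sum: "(\<And>i. i \<in> A \<Longrightarrow> f i \<in> L) \<Longrightarrow> hgt (sum f A) = (\<Sum>i\<in>A. hgt (f i))"
  by (induction A rule: infinite_finite_induct) (auto simp: hgt_add L_sum)

text \<open>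
  Coordinates in \<open>J\<close> have their lower end removed (and their upper end added); coordinates in \<open>A\<close>
  are restricted to one fundamental period. Enlarging \<open>A\<close> by one element multiplies the generating
  function by \<open>1 - t\<close>.
\<close>

definition half_open :: "'c set \<Rightarrow> 'c set \<Rightarrow> nat \<Rightarrow> 'c set" where
  "half_open J A n = {x \<in> L. hgt x = real n \<and>
     (\<forall>e\<in>E. if e \<in> J then 0 < coord x e else 0 \<le> coord x e) \<and>
     (\<forall>e\<in>A. if e \<in> J then coord x e \<le> 1 else coord x e < 1)}"

abbreviation box :: "nat \<Rightarrow> 'c set" where "box \<equiv> half_open {} E"

lemma half_open_nonneg: "x \<in> half_open J A n \<Longrightarrow> e \<in> E \<Longrightarrow> 0 \<le> coord x e"
  unfolding half_open_def by (auto split: if_splits dest!: bspec less_imp_le)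

lemma coord_le_hgt:
  assumes "\<And>e. e \<in> E \<Longrightarrow> 0 \<le> coord x e" "e \<in> E"
  shows "coord x e \<le> hgt x"
  unfolding hgt_def using assms by (intro member_le_sum) (auto simp: finite_E)

lemma finite_bounded_coords: "finite {x \<in> L. \<forall>e\<in>E. \<bar>coord x e\<bar> \<le> b}"
proof -
  define r where "r = (\<Sum>e\<in>E. b * norm e)"
  have "{x \<in> L. \<forall>e\<in>E. \<bar>coord x e\<bar> \<le> b} \<subseteq> L \<inter> cball 0 r"
  proof safe
    fix x assume x: "x \<in> L" "\<forall>e\<in>E. \<bar>coord x e\<bar> \<le> b"
    have "norm x = norm (\<Sum>e\<in>E. coord x e *\<^sub>R e)" using x by (simp add: expand)
    also have "\<dots> \<le> (\<Sum>e\<in>E. norm (coord x e *\<^sub>R e))" by (rule norm_sum)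
    also have "\<dots> \<le> r" unfolding r_def using x by (intro sum_mono) (auto intro: mult_right_mono)
    finally show "x \<in> cball 0 r" by simp
  qed
  then show ?thesis using L_discrete[OF bounded_cball] by (rule finite_subset)
qed

lemma finite_half_open [simp]: "finite (half_open J A n)"
proof (rule finite_subset[OF _ finite_bounded_coords])
  show "half_open J A n \<subseteq> {x \<in> L. \<forall>e\<in>E. \<bar>coord x e\<bar> \<le> real n}"
  proof (intro subsetI CollectI conjI ballI)
    fix x e assume x: "x \<in> half_open J A n" and e: "e \<in> E"
    then have "hgt x = real n" by (simp add: half_open_def)
    then show "\<bar>coord x e\<bar> \<le> real n"
      using coord_le_hgt[of x e] half_open_nonneg[OF x] e by auto
  qed (simp add: half_open_def)
qed

definition series :: "'c set \<Rightarrow> 'c set \<Rightarrow> int fps" where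
  "series J A = Abs_fps (\<lambda>n. int (card (half_open J A n)))"

lemma half_open_insert_0:
  assumes "e \<in> E"
  shows "half_open J (insert e A) 0 = half_open J A 0"
proof -
  have "coord x e \<le> 0" if "x \<in> half_open J A 0" for x
    using coord_le_hgt[of x e] half_open_nonneg[OF that] that assms by (auto simp: half_open_def)
  then show ?thesis unfolding half_open_def by fastforce
qed

text \<open>A point beyond the first period in direction \<open>e\<close> becomes a point one height
  lower when \<open>e\<close> is subtracted.\<close>

lemma half_open_Suc:
  assumes e: "e \<in> E" "e \<notin> A" and A: "A \<subseteq> E"
  shows "half_open J A (Suc n) = half_open J (insert e A) (Suc n) \<union> (+) e ` half_open J A n"
    and "half_open J (insert e A) (Suc n) \<inter> (+) e ` half_open J A n = {}"
proof -
  have eL: "e \<in> L" using e E_L by auto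
  have ce: "coord (e + x) f = (if f = e then 1 else 0) + coord x f" if "x \<in> L" for x f
    using that e eL by (simp add: coord_add coord_basis)
  show "half_open J (insert e A) (Suc n) \<inter> (+) e ` half_open J A n = {}"
  proof safe
    fix x assume x: "x \<in> half_open J A n" "e + x \<in> half_open J (insert e A) (Suc n)"
    then have "x \<in> L" by (simp add: half_open_def)
    then show "e + x \<in> {}" using x e(1) ce[of x e] unfolding half_open_def
      by (auto split: if_splits)
  qed
  show "half_open J A (Suc n) = half_open J (insert e A) (Suc n) \<union> (+) e ` half_open J A n"
  proof (intro equalityI subsetI)
    fix x assume x: "x \<in> half_open J A (Suc n)"
    then have xL: "x \<in> L" by (simp add: half_open_def)
    show "x \<in> half_open J (insert e A) (Suc n) \<union> (+) e ` half_open J A n"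
    proof (cases "if e \<in> J then coord x e \<le> 1 else coord x e < 1")
      case True
      then show ?thesis using x by (auto simp: half_open_def)
    next
      case False
      have cx: "coord (x - e) f = coord x f - (if f = e then 1 else 0)" for f
        using e eL xL by (simp add: coord_diff coord_basis)
      have "x - e \<in> half_open J A n"
        using False x e eL xL A unfolding half_open_def
        by (auto simp: cx L_diff hgt_diff hgt_basis split: if_splits)
      then have "e + (x - e) \<in> (+) e ` half_open J A n" by blast
      then show ?thesis by simp
    qed
  next
    fix x assume "x \<in> half_open J (insert e A) (Suc n) \<union> (+) e ` half_open J A n"
    then show "x \<in> half_open J A (Suc n)"
    proof
      assume "x \<in> half_open J (insert e A) (Suc n)"
      then show ?thesis by (auto simp: half_open_def)
    next
      assume "x \<in> (+) e ` half_open J A n"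
      then obtain y where y: "y \<in> half_open J A n" and x: "x = e + y" by auto
      then have "y \<in> L" by (simp add: half_open_def)
      then show ?thesis using y e eL A unfolding x half_open_def
        by (auto simp: ce L_add hgt_add hgt_basis split: if_splits dest!: bspec)
    qed
  qed
qed

lemma series_insert:
  assumes e: "e \<in> E" "e \<notin> A" and A: "A \<subseteq> E"
  shows "series J (insert e A) = series J A * (1 - fps_X)"
proof (rule fps_ext)
  fix n
  show "series J (insert e A) $ n = (series J A * (1 - fps_X)) $ n"
  proof (cases n)
    case 0
    then show ?thesis using half_open_insert_0[OF e(1)] by (simp add: series_def)
  next
    case (Suc m)
    have "card (half_open J A (Suc m))
        = card (half_open J (insert e A) (Suc m)) + card ((+) e ` half_open J A m)"
      unfolding half_open_Suc(1)[OF assms] using half_open_Suc(2)[OF assms]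
      by (intro card_Un_disjoint) auto
    then have "card (half_open J A (Suc m))
        = card (half_open J (insert e A) (Suc m)) + card (half_open J A m)"
      by (simp add: card_image)
    then show ?thesis by (simp add: Suc series_def algebra_simps)
  qed
qed

text \<open>Restricting the coordinates one at a time costs a factor \<open>1 - fps_X\<close> each,
  so the numerator of the series of a half-open cone counts its box points.\<close>

lemma series_cone:
  "series J {} * (1 - fps_X) ^ card E = series J E"
proof -
  have "series J {} * (1 - fps_X) ^ card A = series J A" if "A \<subseteq> E" for A
    using finite_subset[OF that finite_E] that
    by (induction A) (auto simp: series_insert mult.assoc[symmetric] mult.commute[of "1 - fps_X"])
  then show ?thesis by simp
qed

end

section \<open>Perturbed parameters and the degree functional\<close>

context simplicial_lattice
begin

definition apex :: 'c where "apex = \<Sum>E"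

lemma apex_L: "apex \<in> L"
  unfolding apex_def using E_L by (intro L_sum) auto

lemma coord_apex: "e \<in> E \<Longrightarrow> coord apex e = 1"
  unfolding apex_def using E_L
  by (subst coord_sum) (auto simp: coord_basis finite_E)

lemma hgt_apex: "hgt apex = real (card E)"
  by (simp add: hgt_def coord_apex)

end

text \<open>
  The group ring of the ambient space stands in for Laurent polynomials: \<open>grade y F\<close> is the
  coefficient of \<open>x\<^sup>y\<close> in \<open>F\<close>. Halving exponents is then unproblematic.
\<close>

definition grade :: "'c \<Rightarrow> ('c::real_vector \<Rightarrow>\<^sub>0 bpoly) fps \<Rightarrow> bpoly fps" where
  "grade y F = Abs_fps (\<lambda>n. lookup (F $ n) y)"

lemma grade_nth [simp]: "grade y F $ n = lookup (F $ n) y"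
  by (simp add: grade_def)

lemma grade_add: "grade y (F + G) = grade y F + grade y G"
  by (rule fps_ext) (simp add: lookup_add)

lemma grade_sum: "grade y (\<Sum>i\<in>A. F i) = (\<Sum>i\<in>A. grade y (F i))"
  by (rule fps_ext) (simp add: lookup_sum fps_sum_nth)

lemma grade_single:
  "grade y (fps_const (Poly_Mapping.single z r) * F) = fps_const r * grade (y - z) F"
proof (rule fps_ext)
  fix n
  show "grade y (fps_const (Poly_Mapping.single z r) * F) $ n = (fps_const r * grade (y - z) F) $ n"
    using lookup_single_mult[of z r "F $ n" "y - z"] by simp
qed

lemma grade_X_power: "grade y (fps_X ^ k * F) = fps_X ^ k * grade y F"
  by (rule fps_ext) (simp add: fps_X_power_mult_nth)

lemma grade_X: "grade y (fps_X * F) = fps_X * grade y F"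
  using grade_X_power[of y 1 F] by simp

lemma grade_square: "grade y (F\<^sup>2) = (grade (y /\<^sub>R 2) F)\<^sup>2"
  by (rule fps_ext)
    (simp add: fps_square_nth_char2[OF bpoly_two] lookup_square_char2[OF bpoly_two]
      fps_square_nth_char2[OF poly_mapping_two[OF bpoly_two]])

text \<open>\<open>S\<close> collects the exponents of the perturbing terms. \<open>code\<close>
  names a variable for each pair: \<open>(Some e, s)\<close> for the coefficient of \<open>s\<close>
  in the parameter at \<open>e\<close>, \<open>(None, s)\<close> for its coefficient in the linear
  form \<open>\<ell>\<close> of the growth argument.\<close>

locale perturbation = simplicial_lattice E L for E :: "'c::euclidean_space set" and L +
  fixes S :: "'c set" and code :: "'c option \<times> 'c \<Rightarrow> nat"
  assumes finite_S: "finite S" and S_L: "S \<subseteq> L"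
    and S_nonneg: "\<And>s e. s \<in> S \<Longrightarrow> e \<in> E \<Longrightarrow> 0 \<le> coord s e"
    and code_inj: "inj_on code (insert None (Some ` E) \<times> S)"
begin

definition mon :: "'c option \<times> 'c \<Rightarrow> (nat \<Rightarrow>\<^sub>0 nat)" where
  "mon p = Poly_Mapping.single (code p) 1"

definition var :: "'c option \<times> 'c \<Rightarrow> bpoly" where
  "var p = Poly_Mapping.single (mon p) 1"

text \<open>
  This is \<open>\<theta>\<^sub>e / x\<^sup>e\<close> for the perturbed parameter
  \<open>\<theta>\<^sub>e = x\<^sup>e + \<tau> \<Sum>\<^sub>s X\<^sub>e\<^sub>s x\<^sup>s\<close>, with \<open>fps_X\<close> in the role of \<open>\<tau>\<close>.
\<close>

definition theta :: "'c \<Rightarrow> ('c \<Rightarrow>\<^sub>0 bpoly) fps" where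
  "theta e = 1 + (\<Sum>s\<in>S. fps_X * fps_const (Poly_Mapping.single (s - e) (var (Some e, s))))"

definition Theta :: "'c set \<Rightarrow> ('c \<Rightarrow>\<^sub>0 bpoly) fps" where
  "Theta A = (\<Prod>e\<in>A. theta e)"

text \<open>\<open>Theta A\<close> has constant term 1 in \<open>\<tau>\<close>, hence is a unit;
  the argument 1 is the inverse of that constant term.\<close>

definition iTheta :: "'c set \<Rightarrow> ('c \<Rightarrow>\<^sub>0 bpoly) fps" where
  "iTheta A = fps_right_inverse (Theta A) 1"

text \<open>
  The residue-style formula for the socle functional of the interior ideal modulo the parameters:
  it takes the coefficient of \<open>x\<^bsup>apex\<^esup>\<close> in \<open>x\<^sup>m / \<Prod> (\<theta>\<^sub>e / x\<^sup>e)\<close>.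
\<close>

definition deg :: "'c \<Rightarrow> bpoly fps" where
  "deg m = grade (apex - m) (iTheta E)"

lemma theta_0: "theta e $ 0 = 1"
  by (simp add: theta_def fps_sum_nth)

lemma Theta_0: "Theta A $ 0 = 1"
  unfolding Theta_def
  by (induction A rule: infinite_finite_induct) (auto simp: theta_0 fps_mult_nth_0)

lemma Theta_iTheta: "Theta A * iTheta A = 1"
  unfolding iTheta_def by (rule fps_right_inverse) (simp add: Theta_0)

lemma iTheta_0: "iTheta A $ 0 = 1"
  using arg_cong[OF Theta_iTheta[of A], of "\<lambda>F. F $ 0"] by (simp add: Theta_0 fps_mult_nth_0)

text \<open>At \<open>\<tau>\<close> = 0 the parameters are the bare monomials of \<open>E\<close>,
  and the functional only detects \<open>apex\<close>. The final induction on powers of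
  \<open>\<tau>\<close> rests on this.\<close>

lemma deg_0: "deg m $ 0 = (if m = apex then 1 else 0)"
  by (simp add: deg_def iTheta_0 lookup_one when_def)

section \<open>Supports, and the relations imposed by the parameters\<close>

definition supp_nonneg :: "'c \<Rightarrow> ('c \<Rightarrow>\<^sub>0 bpoly) fps \<Rightarrow> bool" where
  "supp_nonneg e F \<longleftrightarrow> (\<forall>n. \<forall>y \<in> keys (F $ n). y \<in> L \<and> 0 \<le> coord y e)"

lemma supp_nonneg_mult_coeffs:
  assumes "\<forall>y\<in>keys f. y \<in> L \<and> 0 \<le> coord y e" "\<forall>y\<in>keys g. y \<in> L \<and> 0 \<le> coord y e"
  shows "\<forall>y\<in>keys (f * g). y \<in> L \<and> 0 \<le> coord y e"
  using assms keys_mult[of f g] by (force simp: L_add coord_add)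

lemma supp_nonneg_sum_coeffs:
  assumes "\<And>i. i \<in> A \<Longrightarrow> \<forall>y\<in>keys (f i). y \<in> L \<and> 0 \<le> coord y e"
  shows "\<forall>y\<in>keys (sum f A). y \<in> L \<and> 0 \<le> coord y e"
  using assms keys_sum[of f A] by blast

lemma supp_nonneg_mult: "supp_nonneg e F \<Longrightarrow> supp_nonneg e G \<Longrightarrow> supp_nonneg e (F * G)"
  unfolding supp_nonneg_def fps_mult_nth
  by (intro allI supp_nonneg_sum_coeffs supp_nonneg_mult_coeffs) auto

lemma supp_nonneg_one: "supp_nonneg e 1"
  by (auto simp: supp_nonneg_def L_zero)

text \<open>Division by the monomial of \<open>e\<close> can lower only the coordinate at
  \<open>e\<close> itself.\<close>

lemma supp_nonneg_theta:
  assumes "f \<in> E" "e \<in> E" "e \<noteq> f"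
  shows "supp_nonneg f (theta e)"
proof -
  have "\<forall>y\<in>keys (theta e $ n). y \<in> L \<and> 0 \<le> coord y f" for n
  proof -
    have "keys (theta e $ n) \<subseteq> {0} \<union> (\<lambda>s. s - e) ` S"
    proof -
      have "keys ((\<Sum>s\<in>S. fps_X * fps_const (Poly_Mapping.single (s - e) (var (Some e, s)))) $ n)
        \<subseteq> (\<Union>s\<in>S. keys ((fps_X * fps_const (Poly_Mapping.single (s - e) (var (Some e, s)))) $ n))"
        unfolding fps_sum_nth by (rule keys_sum)
      also have "\<dots> \<subseteq> (\<lambda>s. s - e) ` S"
        by (auto split: if_splits)
      finally have 1: "keys ((\<Sum>s\<in>S. fps_X * fps_const (Poly_Mapping.single (s - e) (var (Some e, s)))) $ n)
        \<subseteq> (\<lambda>s. s - e) ` S" .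
      have 2: "keys ((1 :: ('c \<Rightarrow>\<^sub>0 bpoly) fps) $ n) \<subseteq> {0}" by auto
      show ?thesis unfolding theta_def fps_add_nth
        by (rule order_trans[OF keys_add Un_mono[OF 2 1]])
    qed
    moreover have "s - e \<in> L \<and> 0 \<le> coord (s - e) f" if "s \<in> S" for s
    proof -
      have "s \<in> L" "e \<in> L" using that assms S_L E_L by auto
      then show ?thesis using assms S_nonneg[OF that] by (simp add: L_diff coord_diff coord_basis)
    qed
    ultimately show ?thesis using L_zero by auto
  qed
  then show ?thesis by (simp add: supp_nonneg_def)
qed

lemma supp_nonneg_Theta:
  assumes "f \<in> E" "A \<subseteq> E - {f}"
  shows "supp_nonneg f (Theta A)"
proof -
  have "finite A" using assms finite_E finite_subset by blast
  then show ?thesis using assms unfolding Theta_def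
    by (induction A) (auto intro!: supp_nonneg_mult supp_nonneg_theta supp_nonneg_one)
qed

text \<open>Solving \<open>Theta A * iTheta A = 1\<close> power by power of \<open>\<tau>\<close>
  only multiplies, adds and negates coefficients already known to be supported in the
  half-space.\<close>

lemma supp_nonneg_iTheta:
  assumes "f \<in> E" "A \<subseteq> E - {f}"
  shows "supp_nonneg f (iTheta A)"
  unfolding supp_nonneg_def
proof
  fix n
  show "\<forall>y\<in>keys (iTheta A $ n). y \<in> L \<and> 0 \<le> coord y f"
  proof (induction n rule: less_induct)
    case (less n)
    show ?case
    proof (cases n)
      case 0
      then show ?thesis by (auto simp: iTheta_0 L_zero)
    next
      case (Suc m)
      have "0 = (\<Sum>i=0..n. Theta A $ i * iTheta A $ (n - i))"
        using arg_cong[OF Theta_iTheta[of A], of "\<lambda>F. F $ n"] Suc by (simp add: fps_mult_nth)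
      also have "\<dots> = iTheta A $ n + (\<Sum>i=1..n. Theta A $ i * iTheta A $ (n - i))"
        by (simp add: sum.atLeast_Suc_atMost Theta_0)
      finally have eq: "iTheta A $ n = - (\<Sum>i=1..n. Theta A $ i * iTheta A $ (n - i))"
        by (simp only: eq_neg_iff_add_eq_0)
      have "\<forall>y\<in>keys (\<Sum>i=1..n. Theta A $ i * iTheta A $ (n - i)). y \<in> L \<and> 0 \<le> coord y f"
      proof (rule supp_nonneg_sum_coeffs, rule supp_nonneg_mult_coeffs)
        fix i assume "i \<in> {1..n}"
        then have "n - i < n" by auto
        then show "\<forall>y\<in>keys (iTheta A $ (n - i)). y \<in> L \<and> 0 \<le> coord y f" by (rule less)
      qed (use supp_nonneg_Theta[OF assms] in \<open>auto simp: supp_nonneg_def\<close>)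
      then show ?thesis unfolding eq by (simp add: in_keys_iff)
    qed
  qed
qed

lemma theta_iTheta:
  assumes "e \<in> E"
  shows "theta e * iTheta E = iTheta (E - {e})"
proof -
  have T: "Theta E = theta e * Theta (E - {e})"
    unfolding Theta_def using assms finite_E by (simp add: prod.remove)
  have "theta e * iTheta E = (theta e * iTheta E) * (Theta (E - {e}) * iTheta (E - {e}))"
    by (simp add: Theta_iTheta)
  also have "\<dots> = (Theta E * iTheta E) * iTheta (E - {e})"
    unfolding T by (simp only: ac_simps)
  finally show ?thesis by (simp add: Theta_iTheta)
qed

text \<open>Multiplication by \<open>theta e\<close> cancels the one factor whose inverse can reach
  negative \<open>e\<close>-coordinates. The coefficient of the rest at \<open>apex - m - e\<close>,
  whose \<open>e\<close>-coordinate is \<open>- coord m e < 0\<close>, therefore vanishes; expanding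
  \<open>theta e\<close> gives the relation.\<close>

lemma deg_relation:
  assumes m: "m \<in> L" and e: "e \<in> E" and pos: "0 < coord m e"
  shows "deg (m + e) + (\<Sum>s\<in>S. fps_X * (fps_const (var (Some e, s)) * deg (m + s))) = 0"
proof -
  define y where "y = apex - m - e"
  have eL: "e \<in> L" using e E_L by auto
  have "coord y e < 0"
    using m e eL pos by (simp add: y_def coord_diff apex_L L_diff coord_apex coord_basis)
  then have "grade y (theta e * iTheta E) = 0"
    using supp_nonneg_iTheta[of e "E - {e}"] e unfolding theta_iTheta[OF e]
    by (intro fps_ext) (force simp: supp_nonneg_def in_keys_iff)
  moreover have "grade y (theta e * iTheta E)
     = grade y (iTheta E) + (\<Sum>s\<in>S. fps_X * (fps_const (var (Some e, s)) * grade (y - (s - e)) (iTheta E)))"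
    by (simp add: theta_def distrib_right sum_distrib_right grade_add grade_sum mult.assoc
        grade_X grade_single)
  ultimately show ?thesis
    by (simp add: deg_def y_def algebra_simps)
qed

text \<open>
  An element of \<open>opts\<close> picks one summand from each factor \<open>theta e\<close>; \<open>None\<close> stands for the summand 1.
\<close>

definition opts :: "('c \<Rightarrow> 'c option) set" where
  "opts = (\<Pi>\<^sub>E e\<in>E. insert None (Some ` S))"

definition opt_weight :: "('c \<Rightarrow> 'c option) \<Rightarrow> 'c" where
  "opt_weight f = (\<Sum>e\<in>E. case f e of None \<Rightarrow> 0 | Some s \<Rightarrow> s - e)"

definition opt_exponent :: "('c \<Rightarrow> 'c option) \<Rightarrow> (nat \<Rightarrow>\<^sub>0 nat)" where
  "opt_exponent f = (\<Sum>e\<in>E. case f e of None \<Rightarrow> 0 | Some s \<Rightarrow> mon (Some e, s))"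

definition opt_size :: "('c \<Rightarrow> 'c option) \<Rightarrow> nat" where
  "opt_size f = (\<Sum>e\<in>E. case f e of None \<Rightarrow> 0 | Some s \<Rightarrow> 1)"

lemma finite_opts: "finite opts"
  unfolding opts_def using finite_S finite_E by (intro finite_PiE) auto

lemma Theta_expand:
  "Theta E = (\<Sum>f\<in>opts. fps_const (Poly_Mapping.single (opt_weight f) (Poly_Mapping.single (opt_exponent f) 1)) * fps_X ^ opt_size f)"
proof -
  define trm where "trm e o' = (case o' of None \<Rightarrow> 1
    | Some s \<Rightarrow> fps_X * fps_const (Poly_Mapping.single (s - e) (var (Some e, s))))" for e and o' :: "'c option"
  have th: "theta e = (\<Sum>o'\<in>insert None (Some ` S). trm e o')" for e
  proof -
    have "(\<Sum>o'\<in>Some ` S. trm e o') = (\<Sum>s\<in>S. trm e (Some s))"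
      by (simp add: sum.reindex)
    then show ?thesis using finite_S by (simp add: theta_def trm_def)
  qed
  have pr: "(\<Prod>e\<in>A. trm e (f e)) = fps_const (Poly_Mapping.single
       (\<Sum>e\<in>A. case f e of None \<Rightarrow> 0 | Some s \<Rightarrow> s - e)
       (Poly_Mapping.single (\<Sum>e\<in>A. case f e of None \<Rightarrow> 0 | Some s \<Rightarrow> mon (Some e, s)) 1))
       * fps_X ^ (\<Sum>e\<in>A. case f e of None \<Rightarrow> 0 | Some s \<Rightarrow> 1)" if "finite A" for A f
    using that
  proof (induction A)
    case (insert a A)
    then show ?case
    proof (cases "f a")
      case (Some s)
      have "fps_X * fps_const (Poly_Mapping.single (s - a) (var (Some a, s))) *
         (fps_const (Poly_Mapping.single w (Poly_Mapping.single x 1)) * fps_X ^ k)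
        = (fps_const (Poly_Mapping.single (s - a) (var (Some a, s))) *
           fps_const (Poly_Mapping.single w (Poly_Mapping.single x 1))) * fps_X ^ Suc k"
        for w k and x :: "nat \<Rightarrow>\<^sub>0 nat"
        by (simp only: power_Suc ac_simps)
      then show ?thesis using insert Some
        by (simp add: trm_def mult_single var_def)
    qed (simp add: trm_def)
  qed simp
  show ?thesis
    unfolding Theta_def th
    by (subst prod_sum_PiE) (use finite_E finite_S in \<open>auto simp: opts_def opt_weight_def opt_exponent_def opt_size_def pr\<close>)
qed

text \<open>
  From \<open>1/\<Theta> = \<Theta> \<cdot> (1/\<Theta>)\<^sup>2\<close>, where squaring is the Frobenius map.
\<close>

lemma grade_iTheta_frobenius:
  "grade y (iTheta E) = (\<Sum>f\<in>opts. fps_const (Poly_Mapping.single (opt_exponent f) 1) * fps_X ^ opt_size f *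
     (grade ((y - opt_weight f) /\<^sub>R 2) (iTheta E))\<^sup>2)"
proof -
  have "iTheta E = Theta E * iTheta E * iTheta E" by (simp add: Theta_iTheta)
  also have "\<dots> = Theta E * (iTheta E)\<^sup>2" by (simp add: power2_eq_square mult.assoc)
  finally have "grade y (iTheta E) = grade y (Theta E * (iTheta E)\<^sup>2)" by simp
  then show ?thesis
    by (simp add: Theta_expand sum_distrib_right grade_sum mult.assoc grade_single grade_X_power
        grade_square)
qed

section \<open>Independence of the monomials in the Frobenius expansion\<close>

lemma lookup_mon: "lookup (mon p) (code q) = (if code p = code q then 1 else 0)"
  by (simp add: mon_def lookup_single when_def)

lemma lookup_opt_exponent:
  assumes f: "f \<in> opts" and p: "o' \<in> insert None (Some ` E)" "s \<in> S"
  shows "lookup (opt_exponent f) (code (o', s)) = (case o' of None \<Rightarrow> 0 | Some e \<Rightarrow> if f e = Some s then 1 else 0)"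
proof -
  have "lookup (case f e of None \<Rightarrow> 0 | Some s' \<Rightarrow> mon (Some e, s')) (code (o', s))
     = (if o' = Some e \<and> f e = Some s then 1 else 0)" if "e \<in> E" for e
  proof (cases "f e")
    case (Some t)
    then have "t \<in> S" using f that by (auto simp: opts_def PiE_def Pi_def)
    then have "(code (Some e, t) = code (o', s)) = ((Some e, t) = (o', s))"
      using code_inj p that by (intro inj_on_eq_iff[OF code_inj]) auto
    then show ?thesis using Some by (auto simp: lookup_mon)
  qed auto
  then have "lookup (opt_exponent f) (code (o', s)) = (\<Sum>e\<in>E. if o' = Some e \<and> f e = Some s then 1 else 0)"
    unfolding opt_exponent_def lookup_sum by (intro sum.cong) auto
  also have "\<dots> = (case o' of None \<Rightarrow> 0 | Some e \<Rightarrow> if f e = Some s then 1 else 0)"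
  proof (cases o')
    case (Some e)
    then have "(\<Sum>e'\<in>E. if o' = Some e' \<and> f e' = Some s then 1 else 0)
      = (\<Sum>e'\<in>E. if e' = e then (if f e = Some s then 1 else 0) else (0::nat))"
      by (intro sum.cong) auto
    then show ?thesis using p Some finite_E by auto
  qed simp
  finally show ?thesis .
qed

text \<open>For each \<open>e\<close> the single choice \<open>f e\<close> contributes at most one
  variable, and the \<open>None\<close> variables occur only in the extra factor.\<close>

lemma lookup_opt_exponent_le:
  assumes f: "f \<in> opts" and s: "s \<in> S"
  shows "lookup (mon (None, s) + opt_exponent f) k \<le> 1"
proof (cases "k \<in> code ` (insert None (Some ` E) \<times> S)")
  case True
  then obtain o' t where k: "k = code (o', t)" "o' \<in> insert None (Some ` E)" "t \<in> S" by auto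
  have "(code (None, s) = code (o', t)) = ((None, s) = (o', t))"
    using code_inj k s by (intro inj_on_eq_iff[OF code_inj]) auto
  then show ?thesis
    using k by (auto simp: lookup_add lookup_opt_exponent[OF f] lookup_mon split: option.split)
next
  case False
  have z: "lookup (mon p) k = 0" if "p \<in> insert None (Some ` E) \<times> S" for p
    using False that by (auto simp: mon_def lookup_single when_def)
  moreover have "t \<in> S" if "e \<in> E" "f e = Some t" for e t
    using f that by (auto simp: opts_def PiE_def Pi_def)
  ultimately have "lookup (case f e of None \<Rightarrow> 0 | Some t \<Rightarrow> mon (Some e, t)) k = 0"
    if "e \<in> E" for e
    using that by (cases "f e") auto
  then have "lookup (opt_exponent f) k = 0" unfolding opt_exponent_def lookup_sum by simp
  moreover have "lookup (mon (None, s)) k = 0" using z s by blast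
  ultimately show ?thesis by (simp add: lookup_add)
qed

text \<open>The \<open>None\<close> variable reveals \<open>s\<close>, and the variables at
  \<open>Some e\<close> reveal \<open>f e\<close>.\<close>

lemma opt_exponent_inj: "inj_on (\<lambda>(s, f). mon (None, s) + opt_exponent f) (S \<times> opts)"
proof (intro inj_onI, clarify)
  fix s f t g assume st: "s \<in> S" "t \<in> S" "f \<in> opts" "g \<in> opts"
    and eq: "mon (None, s) + opt_exponent f = mon (None, t) + opt_exponent g"
  have l: "lookup (mon (None, s)) k + lookup (opt_exponent f) k = lookup (mon (None, t)) k + lookup (opt_exponent g) k" for k
    using arg_cong[OF eq, of "\<lambda>p. lookup p k"] by (simp add: lookup_add)
  have cd: "(code (None, x) = code (o', y)) = (o' = None \<and> x = y)"
    if "x \<in> S" "y \<in> S" "o' \<in> insert None (Some ` E)" for x y o'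
    using inj_on_eq_iff[OF code_inj, of "(None, x)" "(o', y)"] that by auto
  have "s = t" using l[of "code (None, s)"] st
    by (auto simp: lookup_opt_exponent lookup_mon cd split: if_splits)
  moreover have "f = g"
  proof (rule PiE_ext[of f E "\<lambda>_. insert None (Some ` S)" g])
    fix e assume e: "e \<in> E"
    have iff: "f e = Some x \<longleftrightarrow> g e = Some x" if "x \<in> S" for x
      using l[of "code (Some e, x)"] st that e
      by (auto simp: lookup_opt_exponent lookup_mon cd split: if_splits)
    have "f e \<in> insert None (Some ` S)" "g e \<in> insert None (Some ` S)"
      using st e by (auto simp: opts_def PiE_def Pi_def)
    then show "f e = g e" using iff by (cases "f e"; cases "g e") auto
  qed (use st in \<open>auto simp: opts_def\<close>)
  ultimately show "s = t \<and> f = g" by simp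
qed

end

section \<open>Growth of the box counts\<close>

lemma bpoly_fps_two: "(1::bpoly fps) + 1 = 0"
  using bpoly_two by (metis fps_const_0_eq_0 fps_const_1_eq_1 fps_const_add)

text \<open>\<open>box_gen\<close> is the form in which the decomposition property enters;
  \<open>box_pos\<close>, the interiority of nonzero box points, combines it with cleanness.\<close>

locale idp_simplex = simplicial_lattice +
  assumes box_pos: "\<And>x n e. x \<in> half_open {} E n \<Longrightarrow> 0 < n \<Longrightarrow> e \<in> E \<Longrightarrow> 0 < coord x e"
    and box_gen: "\<And>x n. x \<in> half_open {} E n \<Longrightarrow> 0 < n \<Longrightarrow>
      \<exists>y. (\<forall>k<n. y k \<in> half_open {} E 1) \<and> x = (\<Sum>k<n. y k)"
begin

lemma box_L: "x \<in> box n \<Longrightarrow> x \<in> L"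
  by (simp add: half_open_def)

lemma box_iff: "x \<in> box n \<longleftrightarrow> x \<in> L \<and> hgt x = real n \<and> (\<forall>e\<in>E. 0 \<le> coord x e \<and> coord x e < 1)"
  by (auto simp: half_open_def)

text \<open>Positivity from \<open>box_pos\<close> is what makes the reflected coordinates strictly
  less than 1.\<close>

lemma box_reflect:
  assumes x: "x \<in> box i" and i: "1 \<le> i" "i \<le> card E"
  shows "apex - x \<in> box (card E - i)"
proof -
  have "coord (apex - x) e = 1 - coord x e" if "e \<in> E" for e
    using that x by (simp add: coord_diff apex_L box_L coord_apex)
  then show ?thesis using x i box_pos[OF x]
    by (auto simp: box_iff L_diff apex_L hgt_diff hgt_apex of_nat_diff)
qed

lemma card_box_reflect_le:
  assumes i: "1 \<le> i" "i \<le> card E"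
  shows "card (box i) \<le> card (box (card E - i))"
proof -
  have "inj_on (\<lambda>x. apex - x) (box i)" by (rule inj_onI) simp
  moreover have "(\<lambda>x. apex - x) ` box i \<subseteq> box (card E - i)"
    using box_reflect[OF _ i] by blast
  ultimately show ?thesis by (rule card_inj_on_le) simp
qed

lemma card_box_reflect:
  assumes i: "1 \<le> i" "i < card E"
  shows "card (box (card E - i)) = card (box i)"
proof (rule antisym)
  have "card E - (card E - i) = i" using i by simp
  then show "card (box (card E - i)) \<le> card (box i)"
    using card_box_reflect_le[of "card E - i"] i by simp
qed (use card_box_reflect_le i in simp)

text \<open>If the count dropped, multiplication by \<open>\<ell>\<close> would have a nonzero
  kernel element \<open>u\<close> at height \<open>i\<close>, tested through \<open>deg\<close>; the
  anisotropy argument then forces \<open>u\<close> to be 0.\<close>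

lemma card_box_mono:
  assumes i: "1 \<le> i" "2 * i + 1 \<le> card E"
  shows "card (box i) \<le> card (box (i + 1))"
proof (rule ccontr)
  assume "\<not> card (box i) \<le> card (box (i + 1))"
  moreover have "card E - (i + 1) = card E - i - 1" by simp
  ultimately have less: "card (box (card E - i - 1)) < card (box i)"
    using card_box_reflect[of "i + 1"] i by simp
  \<comment> \<open>The height-one generators serve as monomials of both the parameters and
    \<open>\<ell>\<close>.\<close>
  define S where "S = box 1"
  have fin: "finite (insert None (Some ` E) \<times> S)"
    by (auto simp: S_def finite_E)
  then obtain code :: "'a option \<times> 'a \<Rightarrow> nat" where code: "inj_on code (insert None (Some ` E) \<times> S)"
    using finite_imp_inj_to_nat_seg[OF fin] by metis
  interpret perturbation E L S code
    by unfold_locales (use code in \<open>auto simp: S_def box_iff\<close>)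
  define T where "T s = fps_const (var (None, s))" for s
  \<comment> \<open>The degree of \<open>\<ell>\<close> times the monomials of \<open>g\<close> and
    \<open>z\<close>, where \<open>\<ell>\<close> is the sum of \<open>T s\<close> times the
    monomial of \<open>s\<close>.\<close>
  define a where "a z g = (\<Sum>s\<in>S. T s * deg (g + s + z))" for z g
  \<comment> \<open>By \<open>less\<close> there are fewer test exponents \<open>z\<close> than
    unknown coefficients \<open>u g\<close>.\<close>
  obtain u where u_nz: "\<exists>g\<in>box i. u g \<noteq> 0"
    and u: "\<And>z. z \<in> box (card E - i - 1) \<Longrightarrow> (\<Sum>g\<in>box i. a z g * u g) = 0"
    using underdetermined_system[OF _ _ less, of a] by auto
  \<comment> \<open>The degree of \<open>u\<close> times \<open>\<ell>\<close> times the monomial of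
    \<open>z\<close>, with \<open>u\<close> read as a combination of box monomials.\<close>
  define \<psi> where "\<psi> z = (\<Sum>g\<in>box i. \<Sum>s\<in>S. T s * u g * deg (g + s + z))" for z
  have \<psi>_box: "\<psi> z = 0" if "z \<in> box (card E - i - 1)" for z
    using u[OF that] by (simp add: \<psi>_def a_def sum_distrib_right mult.assoc mult.commute[of "u _"])
  \<comment> \<open>\<open>box_pos\<close> puts every \<open>g\<close> in the interior, so
    \<open>deg_relation\<close> applies to \<open>g + s + b\<close> for each
    \<open>e\<close>.\<close>
  have \<psi>_rel: "\<psi> (b + e) = - (fps_X * (\<Sum>t\<in>S. fps_const (var (Some e, t)) * \<psi> (b + t)))"
    if b: "b \<in> L" "\<forall>f\<in>E. 0 \<le> coord b f" and e: "e \<in> E" for b e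
  proof -
    let ?V = "\<lambda>t. fps_const (var (Some e, t))"
    have rel: "deg (g + s + (b + e)) = - (\<Sum>t\<in>S. fps_X * (?V t * deg (g + s + (b + t))))"
      if g: "g \<in> box i" and s: "s \<in> S" for g s
    proof -
      have gs: "g \<in> L" "s \<in> L" using g s S_L by (auto simp: box_iff)
      have "0 < coord g e" using box_pos[OF g] i e by auto
      then have "0 < coord (g + s + b) e"
        using gs b e S_nonneg[OF s e] by (simp add: coord_add L_add add_pos_nonneg)
      from deg_relation[OF _ e this] show ?thesis
        using gs b by (simp add: L_add add.assoc eq_neg_iff_add_eq_0)
    qed
    have "\<psi> (b + e) = (\<Sum>g\<in>box i. \<Sum>s\<in>S. \<Sum>t\<in>S. - (T s * u g * (fps_X * (?V t * deg (g + s + (b + t))))))"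
      unfolding \<psi>_def by (intro sum.cong refl) (simp add: rel sum_distrib_left sum_negf)
    also have "\<dots> = (\<Sum>g\<in>box i. \<Sum>t\<in>S. \<Sum>s\<in>S. - (T s * u g * (fps_X * (?V t * deg (g + s + (b + t))))))"
      by (intro sum.cong refl sum.swap)
    also have "\<dots> = (\<Sum>t\<in>S. \<Sum>g\<in>box i. \<Sum>s\<in>S. - (T s * u g * (fps_X * (?V t * deg (g + s + (b + t))))))"
      by (rule sum.swap)
    also have "\<dots> = (\<Sum>t\<in>S. \<Sum>g\<in>box i. \<Sum>s\<in>S. - (fps_X * (?V t * (T s * u g * deg (g + s + (b + t))))))"
      by (intro sum.cong refl) (simp only: ac_simps)
    also have "\<dots> = - (fps_X * (\<Sum>t\<in>S. ?V t * \<psi> (b + t)))"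
      by (simp add: \<psi>_def sum_distrib_left sum_negf)
    finally show ?thesis .
  qed
  \<comment> \<open>\<open>\<psi>_rel\<close> trades a vertex in \<open>z\<close> for one power of \<open>\<tau>\<close>\<close>
  have \<psi>_nth: "\<forall>z. z \<in> L \<longrightarrow> (\<forall>e\<in>E. 0 \<le> coord z e) \<longrightarrow> hgt z = real (card E - i - 1) \<longrightarrow> \<psi> z $ n = 0" for n
  proof (induction n rule: less_induct)
    case (less n)
    show ?case
    proof (intro allI impI)
      fix z assume z: "z \<in> L" "\<forall>e\<in>E. 0 \<le> coord z e" "hgt z = real (card E - i - 1)"
      show "\<psi> z $ n = 0"
      proof (cases "\<forall>e\<in>E. coord z e < 1")
        case True
        then have "z \<in> box (card E - i - 1)" using z by (simp add: box_iff)
        then show ?thesis using \<psi>_box by simp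
      next
        case False
        then obtain e where e: "e \<in> E" "1 \<le> coord z e" by (auto simp: not_less)
        define b where "b = z - e"
        have eL: "e \<in> L" using e E_L by auto
        have b: "b \<in> L" "\<forall>f\<in>E. 0 \<le> coord b f" "hgt b = real (card E - i - 1) - 1"
          using z e eL by (auto simp: b_def L_diff coord_diff coord_basis hgt_diff hgt_basis)
        have eq: "\<psi> z = - (fps_X * (\<Sum>t\<in>S. fps_const (var (Some e, t)) * \<psi> (b + t)))"
          using \<psi>_rel[OF b(1,2) e(1)] by (simp add: b_def)
        show ?thesis
        proof (cases n)
          case 0
          then show ?thesis by (simp add: eq)
        next
          case (Suc k)
          \<comment> \<open>\<open>b + t\<close> has the height of \<open>z\<close> again, and the
            factor \<open>fps_X\<close> lowers the order from \<open>n\<close> to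
            \<open>k\<close>.\<close>
          have "\<psi> (b + t) $ k = 0" if t: "t \<in> S" for t
          proof -
            have tL: "t \<in> L" "hgt t = 1" using t by (auto simp: S_def box_iff)
            then have "b + t \<in> L" "\<forall>f\<in>E. 0 \<le> coord (b + t) f" "hgt (b + t) = real (card E - i - 1)"
              using b S_nonneg[OF t] by (auto simp: L_add coord_add hgt_add)
            then show ?thesis using less[of k] Suc by auto
          qed
          then show ?thesis by (simp add: eq Suc fps_sum_nth)
        qed
      qed
    qed
  qed
  have \<psi>_cone: "\<psi> z = 0"
    if "z \<in> L" "\<And>e. e \<in> E \<Longrightarrow> 0 \<le> coord z e" "hgt z = real (card E - i - 1)" for z
    using that \<psi>_nth by (intro fps_ext) auto
  \<comment> \<open>pair with \<open>u\<close> itself; the off-diagonal terms cancel in characteristic 2\<close>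
  have square: "(\<Sum>g\<in>box i. (u g)\<^sup>2 * (\<Sum>s\<in>S. T s * deg (g + g + s + w))) = 0"
    if w: "w \<in> L" "\<And>e. e \<in> E \<Longrightarrow> 0 \<le> coord w e" "hgt w = real (card E - 2 * i - 1)" for w
  proof -
    let ?F = "\<lambda>g h. u g * u h * (\<Sum>s\<in>S. T s * deg (g + h + s + w))"
    have "(\<Sum>g\<in>box i. (u g)\<^sup>2 * (\<Sum>s\<in>S. T s * deg (g + g + s + w))) = (\<Sum>h\<in>box i. ?F h h)"
      by (simp add: power2_eq_square)
    also have "\<dots> = (\<Sum>h\<in>box i. \<Sum>g\<in>box i. ?F h g)"
      by (rule sum_symmetric_char2[OF bpoly_fps_two, symmetric]) (auto simp: ac_simps)
    also have "\<dots> = (\<Sum>h\<in>box i. u h * \<psi> (h + w))"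
      unfolding \<psi>_def sum_distrib_left
      by (intro sum.cong refl) (simp only: ac_simps)
    also have "\<dots> = 0"
    proof (intro sum.neutral ballI)
      fix h assume h: "h \<in> box i"
      \<comment> \<open>The heights add up to
        \<open>i + (card E - 2 * i - 1) = card E - i - 1\<close>.\<close>
      then have "\<psi> (h + w) = 0"
        using w i by (intro \<psi>_cone) (auto simp: box_iff L_add coord_add hgt_add of_nat_diff)
      then show "u h * \<psi> (h + w) = 0" by simp
    qed
    finally show ?thesis .
  qed
  \<comment> \<open>The Frobenius identity turns \<open>square\<close> into a sum over pairs
    \<open>(s, f)\<close> of squares with distinct squarefree coefficients, so every single term
    vanishes. \<open>\<sigma>\<close> prescribes the \<open>f\<close> to look at.\<close>
  have pairing: "(\<Sum>g\<in>box i. u g * deg (g + z)) = 0"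
    if w: "w \<in> L" "\<And>e. e \<in> E \<Longrightarrow> 0 \<le> coord w e" "hgt w = real (card E - 2 * i - 1)"
      and s: "s \<in> S" and \<sigma>: "\<And>e. e \<in> E \<Longrightarrow> \<sigma> e \<in> S" and z: "z + z = s + w + (\<Sum>e\<in>E. \<sigma> e)"
    for w s \<sigma> z
  proof -
    \<comment> \<open>Squaring is additive, so the terms for fixed \<open>(s, f)\<close> merge into
      the one square of \<open>p (s, f)\<close>.\<close>
    define p where "p = (\<lambda>(s, f). \<Sum>g\<in>box i. u g * grade ((apex - (g + g + s + w) - opt_weight f) /\<^sub>R 2) (iTheta E))"
    have "0 = (\<Sum>g\<in>box i. \<Sum>s\<in>S. \<Sum>f\<in>opts. (u g)\<^sup>2 * (T s *
        (fps_const (Poly_Mapping.single (opt_exponent f) 1) * fps_X ^ opt_size f *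
         (grade ((apex - (g + g + s + w) - opt_weight f) /\<^sub>R 2) (iTheta E))\<^sup>2)))"
      using square[OF w] by (simp add: deg_def grade_iTheta_frobenius[of "apex - _"] sum_distrib_left)
    also have "\<dots> = (\<Sum>s\<in>S. \<Sum>g\<in>box i. \<Sum>f\<in>opts. (u g)\<^sup>2 * (T s *
        (fps_const (Poly_Mapping.single (opt_exponent f) 1) * fps_X ^ opt_size f *
         (grade ((apex - (g + g + s + w) - opt_weight f) /\<^sub>R 2) (iTheta E))\<^sup>2)))"
      by (rule sum.swap)
    also have "\<dots> = (\<Sum>s\<in>S. \<Sum>f\<in>opts. \<Sum>g\<in>box i. (u g)\<^sup>2 * (T s *
        (fps_const (Poly_Mapping.single (opt_exponent f) 1) * fps_X ^ opt_size f *
         (grade ((apex - (g + g + s + w) - opt_weight f) /\<^sub>R 2) (iTheta E))\<^sup>2)))"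
      by (intro sum.cong refl sum.swap)
    also have "\<dots> = (\<Sum>s\<in>S. \<Sum>f\<in>opts. fps_const (Poly_Mapping.single (mon (None, s) + opt_exponent f) 1) *
        fps_X ^ opt_size f * (p (s, f))\<^sup>2)"
    proof (intro sum.cong refl)
      fix s f
      have 1: "fps_const (Poly_Mapping.single (mon (None, s) + opt_exponent f) 1)
        = T s * fps_const (Poly_Mapping.single (opt_exponent f) (1::bit))"
        by (simp add: T_def var_def mult_single)
      have "(p (s, f))\<^sup>2 = (\<Sum>g\<in>box i. (u g)\<^sup>2 * (grade ((apex - (g + g + s + w) - opt_weight f) /\<^sub>R 2) (iTheta E))\<^sup>2)"
        unfolding p_def by (simp add: sum_square_char2[OF bpoly_fps_two] power_mult_distrib)
      then show "(\<Sum>g\<in>box i. (u g)\<^sup>2 * (T s *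
        (fps_const (Poly_Mapping.single (opt_exponent f) 1) * fps_X ^ opt_size f *
         (grade ((apex - (g + g + s + w) - opt_weight f) /\<^sub>R 2) (iTheta E))\<^sup>2)))
        = fps_const (Poly_Mapping.single (mon (None, s) + opt_exponent f) 1) * fps_X ^ opt_size f * (p (s, f))\<^sup>2"
        unfolding 1 by (simp only: sum_distrib_left) (intro sum.cong refl, simp only: ac_simps)
    qed
    also have "\<dots> = (\<Sum>x\<in>S \<times> opts. fps_const (Poly_Mapping.single ((\<lambda>(s, f). mon (None, s) + opt_exponent f) x) 1) *
        fps_X ^ ((\<lambda>(s, f). opt_size f) x) * (p x)\<^sup>2)"
      unfolding sum.cartesian_product by (intro sum.cong refl) auto
    finally have 0: "(\<Sum>x\<in>S \<times> opts. fps_const (Poly_Mapping.single ((\<lambda>(s, f). mon (None, s) + opt_exponent f) x) 1) *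
        fps_X ^ ((\<lambda>(s, f). opt_size f) x) * (p x)\<^sup>2) = 0" by simp
    \<comment> \<open>No \<open>None\<close> is chosen, so \<open>opt_weight f\<close> is the sum of
      all \<open>\<sigma> e\<close> minus \<open>apex\<close>.\<close>
    define f where "f = (\<lambda>e\<in>E. Some (\<sigma> e))"
    have f: "f \<in> opts" using \<sigma> by (auto simp: f_def opts_def)
    have "p (s, f) = 0"
    proof (rule bpoly_fps_squarefree_independent[OF _ opt_exponent_inj _ 0])
      show "finite (S \<times> opts)" using finite_S finite_opts by simp
      show "(s, f) \<in> S \<times> opts" using s f by simp
    qed (use lookup_opt_exponent_le in \<open>auto simp del: One_nat_def\<close>)
    moreover have "opt_weight f = (\<Sum>e\<in>E. \<sigma> e) - apex"
      by (simp add: opt_weight_def f_def apex_def sum_subtractf)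
    \<comment> \<open>By the assumption on \<open>z + z\<close>, the exponent is twice
      \<open>apex - (g + z)\<close>, and its half is the exponent read by
      \<open>deg (g + z)\<close>.\<close>
    moreover have "(apex - (g + g + s + w) - ((\<Sum>e\<in>E. \<sigma> e) - apex)) /\<^sub>R 2 = apex - (g + z)" for g
    proof -
      have "apex - (g + g + s + w) - ((\<Sum>e\<in>E. \<sigma> e) - apex) = (apex + apex) - (g + g) - (s + w + (\<Sum>e\<in>E. \<sigma> e))"
        by (simp add: algebra_simps)
      also have "\<dots> = (apex - (g + z)) + (apex - (g + z))"
        unfolding z[symmetric] by (simp add: algebra_simps)
      also have "\<dots> = 2 *\<^sub>R (apex - (g + z))" by (simp add: scaleR_2)
      finally show ?thesis by simp
    qed
    ultimately show ?thesis by (simp add: p_def deg_def)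
  qed
  have pairing_box: "(\<Sum>g\<in>box i. u g * deg (g + z)) = 0" if z: "z \<in> box (card E - i)" for z
  proof -
    define N where "N = card E - i"
    obtain y where y: "\<forall>k<N. y k \<in> S" "z = (\<Sum>k<N. y k)"
      using box_gen[OF z] i by (auto simp: N_def S_def)
    \<comment> \<open>the summands of \<open>2z\<close> in a row: \<open>card E\<close> of them become \<open>\<sigma>\<close>, the next one \<open>s\<close>, the rest \<open>w\<close>\<close>
    define Y where "Y k = (if k < N then y k else y (k - N))" for k
    have Y: "Y k \<in> S" if "k < N + N" for k using that y(1) by (auto simp: Y_def)
    have zz: "z + z = (\<Sum>k<N + N. Y k)"
    proof -
      have "(\<Sum>k<N + N. Y k) = (\<Sum>k<N. Y k) + (\<Sum>k<N. Y (N + k))"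
        by (simp add: lessThan_atLeast0 sum.atLeastLessThan_concat[of 0 N "N + N", symmetric]
            sum.shift_bounds_nat_ivl[of Y 0 N N, simplified] add.commute)
      then show ?thesis by (simp add: Y_def y)
    qed
    obtain h where h: "bij_betw h E {..<card E}"
      using finite_E by (metis bij_betw_iff_card finite_lessThan card_lessThan)
    define w where "w = (\<Sum>k=card E + 1..<N + N. Y k)"
    have split: "z + z = Y (card E) + w + (\<Sum>e\<in>E. Y (h e))"
    proof -
      \<comment> \<open>By the bound on \<open>i\<close>, the \<open>2 * (card E - i)\<close>
        summands number at least \<open>card E + 1\<close>.\<close>
      have "card E < N + N" using i by (auto simp: N_def)
      then have "(\<Sum>k<N + N. Y k) = (\<Sum>k<card E. Y k) + (\<Sum>k=card E..<N + N. Y k)"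
        by (simp add: lessThan_atLeast0 sum.atLeastLessThan_concat)
      also have "(\<Sum>k=card E..<N + N. Y k) = Y (card E) + w"
        using \<open>card E < N + N\<close> by (simp add: w_def sum.atLeast_Suc_lessThan)
      also have "(\<Sum>k<card E. Y k) = (\<Sum>e\<in>E. Y (h e))"
        using sum.reindex_bij_betw[OF h, of Y] by simp
      finally show ?thesis unfolding zz by (simp add: ac_simps)
    qed
    have YL: "Y k \<in> L" "hgt (Y k) = 1" "\<And>e. e \<in> E \<Longrightarrow> 0 \<le> coord (Y k) e" if "k < N + N" for k
      using Y[OF that] by (auto simp: S_def box_iff)
    show ?thesis
    proof (rule pairing[OF _ _ _ _ _ split])
      show "w \<in> L" unfolding w_def by (intro L_sum YL) auto
      show "0 \<le> coord w e" if "e \<in> E" for e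
        unfolding w_def using that by (subst coord_sum) (auto intro!: YL sum_nonneg)
      have "hgt w = (\<Sum>k=card E + 1..<N + N. 1)"
        unfolding w_def by (subst hgt_sum) (auto simp: YL)
      also have "\<dots> = real (N + N - (card E + 1))" by simp
      also have "N + N - (card E + 1) = card E - 2 * i - 1" using i by (auto simp: N_def)
      finally show "hgt w = real (card E - 2 * i - 1)" .
      show "Y (card E) \<in> S" using i by (intro Y) (auto simp: N_def)
      show "Y (h e) \<in> S" if "e \<in> E" for e
        using bij_betwE[OF h] that i by (intro Y) (fastforce simp: N_def)
    qed
  qed
  \<comment> \<open>Test against the mirror image \<open>apex - g0\<close> of \<open>g0\<close>:
    modulo \<open>\<tau>\<close> the degree is 1 for \<open>g = g0\<close> and 0 for the other
    \<open>g\<close>, and the lower coefficients of \<open>u\<close> vanish by induction.\<close>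
  have "\<forall>g\<in>box i. u g $ n = 0" for n
  proof (induction n rule: less_induct)
    case (less n)
    show ?case
    proof
      fix g0 assume g0: "g0 \<in> box i"
      have "0 = (\<Sum>g\<in>box i. (u g * deg (g + (apex - g0))) $ n)"
        using arg_cong[OF pairing_box[OF box_reflect[OF g0]], of "\<lambda>F. F $ n"] i by (simp add: fps_sum_nth)
      also have "\<dots> = (\<Sum>g\<in>box i. if g = g0 then u g0 $ n else 0)"
      proof (intro sum.cong refl)
        fix g assume g: "g \<in> box i"
        have "(u g * deg (g + (apex - g0))) $ n = (\<Sum>k=0..n. u g $ k * deg (g + (apex - g0)) $ (n - k))"
          by (simp add: fps_mult_nth)
        also have "\<dots> = (\<Sum>k=0..n. if k = n then u g $ n * deg (g + (apex - g0)) $ 0 else 0)"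
          using less g by (intro sum.cong) auto
        also have "\<dots> = u g $ n * deg (g + (apex - g0)) $ 0" by simp
        also have "\<dots> = (if g = g0 then u g0 $ n else 0)"
          by (auto simp: deg_0)
        finally show "(u g * deg (g + (apex - g0))) $ n = (if g = g0 then u g0 $ n else 0)" .
      qed
      also have "\<dots> = u g0 $ n" using g0 by simp
      finally show "u g0 $ n = 0" by simp
    qed
  qed
  then have "\<forall>g\<in>box i. u g = 0" by (auto intro: fps_ext)
  with u_nz show False by blast
qed

end

section \<open>Half-open regular triangulations\<close>

text \<open>The weights are chosen one at a time; each functional in which the new weight occurs
  excludes only one value of it.\<close>

lemma generic_weights:
  fixes F :: "('v \<Rightarrow> real) set"
  assumes "finite V" "finite F" "\<And>f. f \<in> F \<Longrightarrow> \<exists>v\<in>V. f v \<noteq> 0"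
  shows "\<exists>\<tau>. (\<forall>v\<in>V. 0 < \<tau> v) \<and> (\<forall>f\<in>F. (\<Sum>v\<in>V. f v * \<tau> v) \<noteq> (0::real))"
  using assms
proof (induction V arbitrary: F rule: finite_induct)
  case empty
  then show ?case by auto
next
  case (insert x V)
  \<comment> \<open>Functionals of \<open>F\<close> outside \<open>F'\<close> involve only the new
    weight.\<close>
  define F' where "F' = {f \<in> F. \<exists>v\<in>V. f v \<noteq> 0}"
  obtain \<tau> where \<tau>: "\<forall>v\<in>V. 0 < \<tau> v" "\<forall>f\<in>F'. (\<Sum>v\<in>V. f v * \<tau> v) \<noteq> 0"
  proof -
    have "finite F'" "\<And>f. f \<in> F' \<Longrightarrow> \<exists>v\<in>V. f v \<noteq> 0"
      using insert.prems(1) by (simp_all add: F'_def)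
    from insert.IH[OF this] show thesis using that by blast
  qed
  define bad where "bad = (\<lambda>f. - (\<Sum>v\<in>V. f v * \<tau> v) / f x) ` F"
  have "infinite ({0<..} - bad)"
    using insert.prems(1) by (intro Diff_infinite_finite) (auto simp: bad_def infinite_Ioi)
  then have "{0<..} - bad \<noteq> {}" by (metis finite.emptyI)
  then obtain t where t: "0 < t" "t \<notin> bad" by blast
  define \<tau>' where "\<tau>' = \<tau>(x := t)"
  have sum: "(\<Sum>v\<in>insert x V. f v * \<tau>' v) = f x * t + (\<Sum>v\<in>V. f v * \<tau> v)" for f :: "'v \<Rightarrow> real"
    using insert.hyps by (auto simp: \<tau>'_def intro!: sum.cong)
  have "(\<Sum>v\<in>insert x V. f v * \<tau>' v) \<noteq> 0" if f: "f \<in> F" for f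
  proof (cases "f x = 0")
    case True
    then have "f \<in> F'" using f insert.prems(2)[OF f] by (auto simp: F'_def)
    then show ?thesis using \<tau> True by (simp add: sum)
  next
    case False
    have "t \<noteq> - (\<Sum>v\<in>V. f v * \<tau> v) / f x" using t(2) f by (auto simp: bad_def)
    then show ?thesis using False unfolding sum by (simp add: field_simps add_eq_0_iff)
  qed
  moreover have "\<forall>v\<in>insert x V. 0 < \<tau>' v" using \<tau> t by (simp add: \<tau>'_def)
  ultimately show ?case by blast
qed

text \<open>The ratio test of the simplex method: \<open>t\<close> is the largest multiple of
  \<open>m\<close> that can be subtracted from \<open>l\<close> without losing nonnegativity, and
  \<open>k\<close> is an entry that becomes 0.\<close>

lemma min_ratio:
  fixes l m :: "'v \<Rightarrow> real"
  assumes "finite U" "\<And>v. v \<in> U \<Longrightarrow> 0 \<le> l v" "\<exists>v\<in>U. 0 < m v"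
  shows "\<exists>t k. 0 \<le> t \<and> k \<in> U \<and> 0 < m k \<and> l k = t * m k \<and> (\<forall>v\<in>U. t * m v \<le> l v)"
proof -
  define P where "P = {v \<in> U. 0 < m v}"
  have P: "finite P" "P \<noteq> {}" using assms by (auto simp: P_def)
  define k where "k = arg_min_on (\<lambda>v. l v / m v) P"
  have k: "k \<in> P" "\<And>v. v \<in> P \<Longrightarrow> l k / m k \<le> l v / m v"
    using arg_min_if_finite[OF P, of "\<lambda>v. l v / m v"] unfolding k_def by force+
  define t where "t = l k / m k"
  have t0: "0 \<le> t" using k assms by (auto simp: t_def P_def)
  moreover have "t * m v \<le> l v" if v: "v \<in> U" for v
  proof (cases "0 < m v")
    case True
    then show ?thesis using k(2)[of v] v by (simp add: P_def t_def pos_le_divide_eq)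
  next
    case False
    then have "t * m v \<le> 0" using t0 by (simp add: mult_nonneg_nonpos)
    then show ?thesis using assms(2)[OF v] by linarith
  qed
  ultimately show ?thesis using k(1) by (intro exI[of _ t] exI[of _ k]) (auto simp: P_def t_def)
qed

lemma representation_sum_scale:
  fixes \<sigma> :: "'c::euclidean_space set"
  assumes "independent \<sigma>" "j \<in> \<sigma>"
  shows "representation \<sigma> (\<Sum>v\<in>\<sigma>. b v *\<^sub>R v) j = b j"
proof -
  have fin: "finite \<sigma>" using assms independent_imp_finite by blast
  have "representation \<sigma> (\<Sum>v\<in>\<sigma>. b v *\<^sub>R v) j = (\<Sum>v\<in>\<sigma>. b v * representation \<sigma> v j)"
    using assms(1) by (simp add: representation_sum representation_scale span_base span_scale)
  also have "\<dots> = (\<Sum>v\<in>\<sigma>. if v = j then b j else 0)"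
    using assms by (intro sum.cong) (auto simp: representation_basis)
  finally show ?thesis using assms(2) fin by simp
qed

section \<open>Cones over point configurations and their bases\<close>

locale configuration =
  fixes V :: "'c::euclidean_space set" and L :: "'c set" and lev :: "'c \<Rightarrow> real"
  assumes finite_V: "finite V" and V_L: "V \<subseteq> L" and L_span: "L \<subseteq> span V"
    and L_zero: "0 \<in> L"
    and L_add: "\<And>x y. x \<in> L \<Longrightarrow> y \<in> L \<Longrightarrow> x + y \<in> L"
    and L_diff: "\<And>x y. x \<in> L \<Longrightarrow> y \<in> L \<Longrightarrow> x - y \<in> L"
    and L_discrete: "\<And>S. bounded S \<Longrightarrow> finite (L \<inter> S)"
    and linear_lev: "linear lev" and lev_V: "\<And>v. v \<in> V \<Longrightarrow> lev v = 1"
begin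

definition cone :: "'c set" where
  "cone = {x. \<exists>a. (\<forall>v\<in>V. 0 \<le> a v) \<and> x = (\<Sum>v\<in>V. a v *\<^sub>R v)}"

definition open_cone :: "'c set" where
  "open_cone = {x. \<exists>a. (\<forall>v\<in>V. 0 < a v) \<and> x = (\<Sum>v\<in>V. a v *\<^sub>R v)}"

lemma open_cone_subset: "open_cone \<subseteq> cone"
  unfolding open_cone_def cone_def by (blast intro: less_imp_le)

definition bases :: "'c set set" where
  "bases = {\<sigma>. \<sigma> \<subseteq> V \<and> independent \<sigma> \<and> span \<sigma> = span V}"

abbreviation rep where "rep \<equiv> representation"

lemma finite_bases: "finite bases"
  using finite_V unfolding bases_def by (rule finite_subset[rotated, OF finite_Pow_iff[THEN iffD2]]) auto

lemma basis_finite: "\<sigma> \<in> bases \<Longrightarrow> finite \<sigma>"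
  using finite_V finite_subset by (auto simp: bases_def)

lemma basis_card: "\<sigma> \<in> bases \<Longrightarrow> card \<sigma> = dim V"
  by (metis (mono_tags, lifting) bases_def dim_eq_card_independent dim_span mem_Collect_eq)

lemma lev_sum: "lev (\<Sum>v\<in>A. a v *\<^sub>R v) = (\<Sum>v\<in>A. a v)" if "A \<subseteq> V"
  using that linear_lev by (auto simp: linear_sum linear_scale lev_V intro!: sum.cong)

lemma rep_expand: "\<sigma> \<in> bases \<Longrightarrow> x \<in> span V \<Longrightarrow> (\<Sum>j\<in>\<sigma>. rep \<sigma> x j *\<^sub>R j) = x"
  using basis_finite by (intro sum_representation_eq) (auto simp: bases_def)

lemma rep_add: "\<sigma> \<in> bases \<Longrightarrow> x \<in> span V \<Longrightarrow> y \<in> span V \<Longrightarrow> rep \<sigma> (x + y) j = rep \<sigma> x j + rep \<sigma> y j"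
  by (simp add: bases_def representation_add)

lemma rep_scale: "\<sigma> \<in> bases \<Longrightarrow> x \<in> span V \<Longrightarrow> rep \<sigma> (r *\<^sub>R x) j = r * rep \<sigma> x j"
  by (simp add: bases_def representation_scale)

lemma cone_span: "x \<in> cone \<Longrightarrow> x \<in> span V"
  by (auto simp: cone_def span_base intro!: span_sum span_scale)

lemma coneI:
  assumes "\<sigma> \<subseteq> V" "\<And>v. v \<in> \<sigma> \<Longrightarrow> 0 \<le> a v" "x = (\<Sum>v\<in>\<sigma>. a v *\<^sub>R v)"
  shows "x \<in> cone"
proof -
  have "x = (\<Sum>v\<in>V. (if v \<in> \<sigma> then a v else 0) *\<^sub>R v)"
    unfolding assms(3) using assms(1) finite_V
    by (intro sum.mono_neutral_cong_left) auto
  then show ?thesis unfolding cone_def using assms(2) by (intro CollectI exI[of _ "\<lambda>v. if v \<in> \<sigma> then a v else 0"]) auto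
qed

text \<open>Caratheodory's argument: subtract a multiple of a dependency until a coefficient becomes
  0. Since \<open>lev\<close> forces the dependency to sum to 0, it has a positive entry, as
  \<open>min_ratio\<close> requires.\<close>

lemma cone_independent:
  assumes "U \<subseteq> V" "\<And>v. v \<in> U \<Longrightarrow> 0 \<le> a v" "x = (\<Sum>v\<in>U. a v *\<^sub>R v)"
  shows "\<exists>U b. U \<subseteq> V \<and> independent U \<and> (\<forall>v\<in>U. 0 \<le> b v) \<and> x = (\<Sum>v\<in>U. b v *\<^sub>R v)"
  using assms
proof (induction "card U" arbitrary: U a rule: less_induct)
  case less
  show ?case
  proof (cases "independent U")
    case True
    then show ?thesis using less.prems by blast
  next
    case False
    have fin: "finite U" using less.prems finite_V finite_subset by blast
    obtain m where m: "\<exists>v\<in>U. m v \<noteq> 0" "(\<Sum>v\<in>U. m v *\<^sub>R v) = 0"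
      using False fin by (auto simp: dependent_finite)
    have "(\<Sum>v\<in>U. m v) = 0"
      using lev_sum[OF less.prems(1), of m] m linear_lev by (simp add: linear_0)
    then have mpos: "\<exists>v\<in>U. 0 < m v"
      using m(1) fin sum_nonneg_eq_0_iff[of U "\<lambda>v. - m v"] by (force simp: sum_negf not_less)
    have "\<exists>t k. 0 \<le> t \<and> k \<in> U \<and> 0 < m k \<and> a k = t * m k \<and> (\<forall>v\<in>U. t * m v \<le> a v)"
      by (rule min_ratio[OF fin _ mpos]) (use less.prems in auto)
    then obtain t k where t: "k \<in> U" "a k = t * m k" "\<forall>v\<in>U. t * m v \<le> a v" by blast
    have "x = (\<Sum>v\<in>U. (a v - t * m v) *\<^sub>R v)"
    proof -
      have "(\<Sum>v\<in>U. (t * m v) *\<^sub>R v) = t *\<^sub>R (\<Sum>v\<in>U. m v *\<^sub>R v)"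
        by (simp add: scaleR_sum_right)
      then show ?thesis using less.prems(3) m(2) by (simp add: scaleR_diff_left sum_subtractf)
    qed
    also have "\<dots> = (\<Sum>v\<in>U - {k}. (a v - t * m v) *\<^sub>R v)"
      using t fin by (simp add: sum.remove[of U k])
    finally have "x = (\<Sum>v\<in>U - {k}. (a v - t * m v) *\<^sub>R v)" .
    moreover have "card (U - {k}) < card U" using t(1) fin by (intro card_Diff1_less)
    ultimately show ?thesis using less.hyps[of "U - {k}" "\<lambda>v. a v - t * m v"] less.prems(1) t(3) by auto
  qed
qed

text \<open>The independent set from \<open>cone_independent\<close> is completed to a basis, the
  added vectors getting coefficient 0.\<close>

lemma cone_basis:
  assumes "x \<in> cone"
  shows "\<exists>\<sigma>\<in>bases. \<forall>j\<in>\<sigma>. 0 \<le> rep \<sigma> x j"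
proof -
  obtain a where "\<forall>v\<in>V. 0 \<le> a v" "x = (\<Sum>v\<in>V. a v *\<^sub>R v)" using assms by (auto simp: cone_def)
  then obtain U b where U: "U \<subseteq> V" "independent U" "\<forall>v\<in>U. 0 \<le> b v" "x = (\<Sum>v\<in>U. b v *\<^sub>R v)"
    using cone_independent[of V a x] by auto
  obtain \<sigma> where \<sigma>: "U \<subseteq> \<sigma>" "\<sigma> \<subseteq> V" "independent \<sigma>" "V \<subseteq> span \<sigma>"
    using maximal_independent_subset_extend[OF U(1,2)] by blast
  have "span \<sigma> = span V" using \<sigma> by (meson span_eq span_superset subset_trans)
  then have "\<sigma> \<in> bases" using \<sigma> by (simp add: bases_def)
  moreover have "x = (\<Sum>v\<in>\<sigma>. (if v \<in> U then b v else 0) *\<^sub>R v)"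
    unfolding U(4) using \<sigma>(1) basis_finite[OF \<open>\<sigma> \<in> bases\<close>] by (intro sum.mono_neutral_cong_left) auto
  then have "0 \<le> rep \<sigma> x j" if "j \<in> \<sigma>" for j
    using representation_sum_scale[OF \<sigma>(3) that] U(3) by simp
  ultimately show ?thesis by blast
qed

definition generic :: "'c \<Rightarrow> bool" where
  "generic y \<longleftrightarrow> y \<in> span V \<and> (\<forall>\<sigma>\<in>bases. \<forall>j\<in>\<sigma>. rep \<sigma> y j \<noteq> 0)"

text \<open>Positivity of \<open>a + \<epsilon> * b\<close> for all small
  \<open>\<epsilon> > 0\<close>.\<close>

definition lexpos :: "real \<Rightarrow> real \<Rightarrow> bool" where
  "lexpos a b \<longleftrightarrow> 0 < a \<or> a = 0 \<and> 0 < b"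

text \<open>
  \<open>x + \<epsilon> s\<close> lies in the open cone over \<open>\<sigma>\<close> for all small \<open>\<epsilon> > 0\<close>.
\<close>

definition lex_inside :: "'c \<Rightarrow> 'c set \<Rightarrow> 'c \<Rightarrow> bool" where
  "lex_inside s \<sigma> x \<longleftrightarrow> (\<forall>j\<in>\<sigma>. lexpos (rep \<sigma> x j) (rep \<sigma> s j))"

lemma lexpos_eventually:
  assumes "b \<noteq> 0"
  shows "eventually (\<lambda>\<epsilon>. a + \<epsilon> * b \<noteq> 0 \<and> (0 < a + \<epsilon> * b \<longleftrightarrow> lexpos a b)) (at_right 0)"
proof (cases "a = 0")
  case True
  then show ?thesis using assms eventually_at_right_less[of 0]
    by (auto elim!: eventually_mono simp: lexpos_def zero_less_mult_iff)
next
  case False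
  have lim: "((\<lambda>\<epsilon>. a + \<epsilon> * b) \<longlongrightarrow> a + 0 * b) (at_right 0)"
    by (intro tendsto_intros)
  show ?thesis
  proof (cases "0 < a")
    case True
    then have "eventually (\<lambda>\<epsilon>. 0 < a + \<epsilon> * b) (at_right 0)"
      using order_tendstoD(1)[OF lim, of 0] by simp
    then show ?thesis using True by (auto elim!: eventually_mono simp: lexpos_def)
  next
    case F: False
    then have "eventually (\<lambda>\<epsilon>. a + \<epsilon> * b < 0) (at_right 0)"
      using order_tendstoD(2)[OF lim, of 0] False by simp
    then show ?thesis using F False by (auto elim!: eventually_mono simp: lexpos_def)
  qed
qed

text \<open>Only finitely many sign conditions are involved, so one small \<open>\<epsilon>\<close>
  serves all bases at once.\<close>

lemma perturb:
  assumes s: "generic s" and x: "x \<in> span V"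
  obtains \<epsilon> where "0 < \<epsilon>" "generic (x + \<epsilon> *\<^sub>R s)"
    "\<And>\<sigma>. \<sigma> \<in> bases \<Longrightarrow> (\<forall>j\<in>\<sigma>. 0 < rep \<sigma> (x + \<epsilon> *\<^sub>R s) j) \<longleftrightarrow> lex_inside s \<sigma> x"
proof -
  have "eventually (\<lambda>\<epsilon>. \<forall>\<sigma>\<in>bases. \<forall>j\<in>\<sigma>. rep \<sigma> x j + \<epsilon> * rep \<sigma> s j \<noteq> 0 \<and>
      (0 < rep \<sigma> x j + \<epsilon> * rep \<sigma> s j \<longleftrightarrow> lexpos (rep \<sigma> x j) (rep \<sigma> s j))) (at_right 0)"
    using s basis_finite finite_bases
    by (intro eventually_ball_finite ballI lexpos_eventually) (auto simp: generic_def)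
  then have "eventually (\<lambda>\<epsilon>. 0 < \<epsilon> \<and> (\<forall>\<sigma>\<in>bases. \<forall>j\<in>\<sigma>. rep \<sigma> x j + \<epsilon> * rep \<sigma> s j \<noteq> 0 \<and>
      (0 < rep \<sigma> x j + \<epsilon> * rep \<sigma> s j \<longleftrightarrow> lexpos (rep \<sigma> x j) (rep \<sigma> s j)))) (at_right 0)"
    using eventually_at_right_less[of 0] by eventually_elim auto
  then obtain \<epsilon> where \<epsilon>: "0 < \<epsilon>" "\<forall>\<sigma>\<in>bases. \<forall>j\<in>\<sigma>. rep \<sigma> x j + \<epsilon> * rep \<sigma> s j \<noteq> 0 \<and>
      (0 < rep \<sigma> x j + \<epsilon> * rep \<sigma> s j \<longleftrightarrow> lexpos (rep \<sigma> x j) (rep \<sigma> s j))"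
    by (auto dest!: eventually_happens)
  have sp: "s \<in> span V" using s by (simp add: generic_def)
  have r: "rep \<sigma> (x + \<epsilon> *\<^sub>R s) j = rep \<sigma> x j + \<epsilon> * rep \<sigma> s j" if "\<sigma> \<in> bases" for \<sigma> j
    using that x sp by (simp add: rep_add rep_scale span_scale)
  show thesis
  proof (rule that[OF \<epsilon>(1)])
    show "generic (x + \<epsilon> *\<^sub>R s)"
      unfolding generic_def using \<epsilon>(2) x sp by (auto simp: r intro!: span_add span_scale)
    show "(\<forall>j\<in>\<sigma>. 0 < rep \<sigma> (x + \<epsilon> *\<^sub>R s) j) \<longleftrightarrow> lex_inside s \<sigma> x" if "\<sigma> \<in> bases" for \<sigma>
      using that \<epsilon>(2) by (auto simp: r lex_inside_def)
  qed
qed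

lemma basis_simplicial: "\<sigma> \<in> bases \<Longrightarrow> simplicial_lattice \<sigma> L"
  using V_L L_span by unfold_locales (auto simp: bases_def L_zero intro: L_add L_diff L_discrete)

lemma simplicial_hgt:
  assumes \<sigma>: "\<sigma> \<in> bases" and x: "x \<in> span V"
  shows "simplicial_lattice.hgt \<sigma> x = lev x"
proof -
  interpret simplicial_lattice \<sigma> L using \<sigma> by (rule basis_simplicial)
  have "lev (\<Sum>j\<in>\<sigma>. rep \<sigma> x j *\<^sub>R j) = (\<Sum>j\<in>\<sigma>. rep \<sigma> x j)"
    using \<sigma> by (intro lev_sum) (simp add: bases_def)
  then show ?thesis unfolding rep_expand[OF \<sigma> x] by (simp add: hgt_def coord_def)
qed

definition slice :: "nat \<Rightarrow> 'c set" where
  "slice n = {x \<in> L. x \<in> cone \<and> lev x = real n}"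

end

section \<open>The regular triangulation of generic weights\<close>

locale weighted_configuration = configuration +
  fixes w :: "'a \<Rightarrow> real"
  assumes w_generic: "\<And>\<sigma> v. \<sigma> \<in> bases \<Longrightarrow> v \<in> V - \<sigma> \<Longrightarrow>
    (\<Sum>j\<in>\<sigma>. rep \<sigma> v j * w j) \<noteq> w v"
begin

text \<open>The linear function on the span that agrees with \<open>w\<close> on
  \<open>\<sigma>\<close>.\<close>

definition interp :: "'a set \<Rightarrow> 'a \<Rightarrow> real" where
  "interp \<sigma> x = (\<Sum>j\<in>\<sigma>. rep \<sigma> x j * w j)"

text \<open>
  The lower facets of the lifting \<open>v \<mapsto> (v, w v)\<close>, i.e. the regular triangulation induced by \<open>w\<close>.
\<close>

definition triangulation :: "'a set set" where
  "triangulation = {\<sigma> \<in> bases. \<forall>v\<in>V - \<sigma>. interp \<sigma> v < w v}"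

lemma triangulation_bases: "\<sigma> \<in> triangulation \<Longrightarrow> \<sigma> \<in> bases"
  by (simp add: triangulation_def)

lemma interp_sum:
  assumes "\<sigma> \<in> bases" "finite A" "A \<subseteq> span V"
  shows "interp \<sigma> (\<Sum>v\<in>A. a v *\<^sub>R v) = (\<Sum>v\<in>A. a v * interp \<sigma> v)"
proof -
  have "rep \<sigma> (\<Sum>v\<in>A. a v *\<^sub>R v) j = (\<Sum>v\<in>A. a v * rep \<sigma> v j)" for j
    using assms by (subst representation_sum) (auto simp: bases_def representation_scale subset_iff intro!: span_scale sum.cong)
  then have "interp \<sigma> (\<Sum>v\<in>A. a v *\<^sub>R v) = (\<Sum>j\<in>\<sigma>. \<Sum>v\<in>A. a v * (rep \<sigma> v j * w j))"
    by (simp add: interp_def sum_distrib_right mult.assoc)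
  also have "\<dots> = (\<Sum>v\<in>A. \<Sum>j\<in>\<sigma>. a v * (rep \<sigma> v j * w j))" by (rule sum.swap)
  finally show ?thesis by (simp add: interp_def sum_distrib_left)
qed

lemma interp_basis: "\<sigma> \<in> bases \<Longrightarrow> j \<in> \<sigma> \<Longrightarrow> interp \<sigma> j = w j"
  using basis_finite unfolding interp_def
  by (subst sum.cong[OF refl, of _ _ "\<lambda>k. if k = j then w j else 0"])
    (auto simp: bases_def representation_basis)

text \<open>On \<open>V\<close> the function \<open>interp \<sigma>\<close> lies below
  \<open>w\<close>, strictly so off \<open>\<sigma>\<close>. As both bases have the same size,
  \<open>\<sigma>'\<close> has a vector outside \<open>\<sigma>\<close>, and \<open>y\<close> uses
  it with positive weight.\<close>

lemma interp_less:
  assumes "\<sigma> \<in> triangulation" "\<sigma>' \<in> bases" "\<sigma> \<noteq> \<sigma>'" "y \<in> span V" "\<forall>j\<in>\<sigma>'. 0 < rep \<sigma>' y j"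
  shows "interp \<sigma> y < interp \<sigma>' y"
proof -
  have \<sigma>: "\<sigma> \<in> bases" using assms(1) by (rule triangulation_bases)
  have "\<not> \<sigma>' \<subseteq> \<sigma>"
    using card_subset_eq[OF basis_finite[OF \<sigma>], of \<sigma>'] basis_card[OF \<sigma>] basis_card[OF assms(2)] assms(3) by auto
  then obtain k where k: "k \<in> \<sigma>'" "k \<notin> \<sigma>" by auto
  have sub: "\<sigma>' \<subseteq> V" using assms(2) by (simp add: bases_def)
  have le: "interp \<sigma> v \<le> w v" if "v \<in> V" for v
    using that assms(1) interp_basis[OF \<sigma>] by (cases "v \<in> \<sigma>") (auto simp: triangulation_def less_imp_le)
  have "interp \<sigma> y = interp \<sigma> (\<Sum>j\<in>\<sigma>'. rep \<sigma>' y j *\<^sub>R j)"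
    using rep_expand[OF assms(2,4)] by simp
  also have "\<dots> = (\<Sum>j\<in>\<sigma>'. rep \<sigma>' y j * interp \<sigma> j)"
    using sub basis_finite[OF assms(2)] span_superset by (intro interp_sum \<sigma>) auto
  also have "\<dots> < (\<Sum>j\<in>\<sigma>'. rep \<sigma>' y j * w j)"
  proof (rule sum_strict_mono_ex1[OF basis_finite[OF assms(2)]])
    show "\<forall>j\<in>\<sigma>'. rep \<sigma>' y j * interp \<sigma> j \<le> rep \<sigma>' y j * w j"
      using assms(5) le sub by (auto intro!: mult_left_mono)
    have "interp \<sigma> k < w k" using k sub assms(1) by (auto simp: triangulation_def)
    then show "\<exists>j\<in>\<sigma>'. rep \<sigma>' y j * interp \<sigma> j < rep \<sigma>' y j * w j"
      using k assms(5) by (intro bexI[of _ k]) auto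
  qed
  finally show ?thesis by (simp add: interp_def)
qed

text \<open>If the two differed, \<open>interp_less\<close> would apply in both directions.\<close>

lemma triangulation_unique:
  assumes "\<sigma> \<in> triangulation" "\<sigma>' \<in> triangulation" "y \<in> span V"
    "\<forall>j\<in>\<sigma>. 0 < rep \<sigma> y j" "\<forall>j\<in>\<sigma>'. 0 < rep \<sigma>' y j"
  shows "\<sigma> = \<sigma>'"
  using interp_less[OF assms(1) triangulation_bases[OF assms(2)] _ assms(3,5)]
    interp_less[OF assms(2) triangulation_bases[OF assms(1)] _ assms(3,4)] by fastforce

text \<open>A simplex pivot: \<open>v\<close> enters, and \<open>min_ratio\<close> picks the vector
  \<open>k\<close> that leaves. The value at \<open>y\<close> drops by
  \<open>t * (interp \<sigma> v - w v)\<close>.\<close>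

lemma pivot:
  assumes \<sigma>: "\<sigma> \<in> bases" and y: "generic y" "\<forall>j\<in>\<sigma>. 0 < rep \<sigma> y j"
    and v: "v \<in> V - \<sigma>" "w v < interp \<sigma> v"
  shows "\<exists>\<sigma>'\<in>bases. (\<forall>j\<in>\<sigma>'. 0 < rep \<sigma>' y j) \<and> interp \<sigma>' y < interp \<sigma> y"
proof -
  have sp: "y \<in> span V" "v \<in> span V" using y v by (auto simp: generic_def span_base)
  have fin: "finite \<sigma>" using basis_finite \<sigma> .
  have sub: "\<sigma> \<subseteq> V" "independent \<sigma>" "span \<sigma> = span V" using \<sigma> by (auto simp: bases_def)
  let ?m = "rep \<sigma> v" and ?l = "rep \<sigma> y"
  have "(\<Sum>j\<in>\<sigma>. ?m j) = lev v"
    using lev_sum[OF sub(1), of ?m] rep_expand[OF \<sigma> sp(2)] by simp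
  then have "(\<Sum>j\<in>\<sigma>. ?m j) = 1" using v lev_V by simp
  then have "\<exists>j\<in>\<sigma>. 0 < ?m j" by (metis not_less sum_nonpos zero_less_one)
  from min_ratio[OF fin _ this, of ?l] y(2)
  obtain t k where t: "0 \<le> t" "k \<in> \<sigma>" "0 < ?m k" "?l k = t * ?m k" "\<forall>j\<in>\<sigma>. t * ?m j \<le> ?l j"
    by (auto simp: less_imp_le)
  have "t \<noteq> 0" using t y(2) by force
  then have t0: "0 < t" using t(1) by simp
  define \<sigma>' where "\<sigma>' = insert v (\<sigma> - {k})"
  have vk: "v \<noteq> k" "v \<notin> \<sigma>" using v t by auto
  have vexp: "v = ?m k *\<^sub>R k + (\<Sum>j\<in>\<sigma> - {k}. ?m j *\<^sub>R j)"
    using rep_expand[OF \<sigma> sp(2)] sum.remove[OF fin t(2), of "\<lambda>j. ?m j *\<^sub>R j"] by simp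
  have vnot: "v \<notin> span (\<sigma> - {k})"
  proof
    assume "v \<in> span (\<sigma> - {k})"
    then have "v - (\<Sum>j\<in>\<sigma> - {k}. ?m j *\<^sub>R j) \<in> span (\<sigma> - {k})"
      by (intro span_diff span_sum span_scale) (auto intro: span_base)
    then have "?m k *\<^sub>R k \<in> span (\<sigma> - {k})" using vexp by (metis add_diff_cancel_right')
    from span_scale[OF this, of "1 / ?m k"] have "k \<in> span (\<sigma> - {k})" using t(3) by simp
    then show False using sub(2) t(2) by (auto simp: dependent_def)
  qed
  have indep': "independent \<sigma>'"
    unfolding \<sigma>'_def using vnot independent_mono[OF sub(2), of "\<sigma> - {k}"] by (intro independent_insertI) auto
  have card': "card \<sigma>' = card \<sigma>"
  proof -
    have "card \<sigma>' = Suc (card (\<sigma> - {k}))"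
      unfolding \<sigma>'_def using vk fin by (intro card_insert_disjoint) auto
    then show ?thesis using card_Suc_Diff1[OF fin t(2)] by (simp only:)
  qed
  have sub': "\<sigma>' \<subseteq> V" using sub v by (auto simp: \<sigma>'_def)
  have "span \<sigma>' = span V"
  proof -
    have "dim \<sigma>' = dim V" using indep' card' basis_card[OF \<sigma>] by (simp add: dim_eq_card_independent)
    then show ?thesis using sub' by (metis dim_eq_span order_refl)
  qed
  then have \<sigma>': "\<sigma>' \<in> bases" using sub' indep' by (simp add: bases_def)
  \<comment> \<open>Coordinates of \<open>y\<close> in the new basis: \<open>t\<close> times the
    expansion of \<open>v\<close> is traded for \<open>t\<close> copies of \<open>v\<close>, which
    removes \<open>k\<close>.\<close>
  define b where "b j = (if j = v then t else ?l j - t * ?m j)" for j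
  have yexp: "y = (\<Sum>j\<in>\<sigma>'. b j *\<^sub>R j)"
  proof -
    have "(\<Sum>j\<in>\<sigma>'. b j *\<^sub>R j) = t *\<^sub>R v + (\<Sum>j\<in>\<sigma> - {k}. (?l j - t * ?m j) *\<^sub>R j)"
    proof -
      have "(\<Sum>j\<in>\<sigma> - {k}. b j *\<^sub>R j) = (\<Sum>j\<in>\<sigma> - {k}. (?l j - t * ?m j) *\<^sub>R j)"
        using vk by (intro sum.cong) (auto simp: b_def)
      then show ?thesis using vk fin by (simp add: \<sigma>'_def b_def)
    qed
    also have "(\<Sum>j\<in>\<sigma> - {k}. (?l j - t * ?m j) *\<^sub>R j) = (\<Sum>j\<in>\<sigma>. (?l j - t * ?m j) *\<^sub>R j)"
      using t fin by (simp add: sum.remove[of \<sigma> k])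
    also have "\<dots> = y - t *\<^sub>R v"
      using rep_expand[OF \<sigma> sp(1)] rep_expand[OF \<sigma> sp(2)]
      by (simp add: scaleR_diff_left sum_subtractf scaleR_sum_right[symmetric] flip: scaleR_scaleR)
    finally show ?thesis by simp
  qed
  have repb: "rep \<sigma>' y j = b j" if "j \<in> \<sigma>'" for j
    unfolding yexp using representation_sum_scale[OF indep' that] .
  \<comment> \<open>The ratio test gives only nonnegativity; genericity of \<open>y\<close> makes it
    strict.\<close>
  have pos: "0 < rep \<sigma>' y j" if j: "j \<in> \<sigma>'" for j
  proof -
    have "0 \<le> b j" using j t(1,5) by (auto simp: b_def \<sigma>'_def)
    moreover have "rep \<sigma>' y j \<noteq> 0" using y(1) \<sigma>' j by (auto simp: generic_def)
    ultimately show ?thesis using repb[OF j] by simp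
  qed
  have "interp \<sigma>' y = (\<Sum>j\<in>\<sigma>'. b j * w j)"
    unfolding interp_def using repb by (intro sum.cong) auto
  also have "\<dots> = t * w v + (\<Sum>j\<in>\<sigma> - {k}. (?l j - t * ?m j) * w j)"
  proof -
    have "(\<Sum>j\<in>\<sigma> - {k}. b j * w j) = (\<Sum>j\<in>\<sigma> - {k}. (?l j - t * ?m j) * w j)"
      using vk by (intro sum.cong) (auto simp: b_def)
    then show ?thesis using vk fin by (simp add: \<sigma>'_def b_def)
  qed
  also have "(\<Sum>j\<in>\<sigma> - {k}. (?l j - t * ?m j) * w j) = (\<Sum>j\<in>\<sigma>. (?l j - t * ?m j) * w j)"
    using t fin by (simp add: sum.remove[of \<sigma> k])
  also have "\<dots> = interp \<sigma> y - t * interp \<sigma> v"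
    by (simp add: interp_def sum_subtractf sum_distrib_left algebra_simps)
  finally have "interp \<sigma>' y = interp \<sigma> y - t * (interp \<sigma> v - w v)" by (simp add: algebra_simps)
  then have "interp \<sigma>' y < interp \<sigma> y" using t0 v(2) by simp
  then show ?thesis using \<sigma>' pos by blast
qed

text \<open>Linear programming: among the bases whose open cone contains \<open>y\<close>, one
  minimizing the interpolated weight admits no pivot, hence is a lower facet.\<close>

lemma triangulation_exists:
  assumes y: "generic y" "y \<in> cone"
  shows "\<exists>\<sigma>\<in>triangulation. \<forall>j\<in>\<sigma>. 0 < rep \<sigma> y j"
proof -
  define N where "N = {\<sigma> \<in> bases. \<forall>j\<in>\<sigma>. 0 < rep \<sigma> y j}"
  obtain \<sigma>0 where "\<sigma>0 \<in> bases" "\<forall>j\<in>\<sigma>0. 0 \<le> rep \<sigma>0 y j" using cone_basis[OF y(2)] by blast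
  then have "\<sigma>0 \<in> N" using y(1) by (force simp: N_def generic_def less_le)
  then have N: "finite N" "N \<noteq> {}" using finite_bases by (auto simp: N_def)
  define \<sigma> where "\<sigma> = arg_min_on (\<lambda>\<sigma>. interp \<sigma> y) N"
  have \<sigma>: "\<sigma> \<in> N" "\<And>\<sigma>'. \<sigma>' \<in> N \<Longrightarrow> \<not> interp \<sigma>' y < interp \<sigma> y"
    using arg_min_if_finite[OF N, of "\<lambda>\<sigma>. interp \<sigma> y"] unfolding \<sigma>_def by blast+
  have "interp \<sigma> v < w v" if v: "v \<in> V - \<sigma>" for v
  proof (rule ccontr)
    assume "\<not> interp \<sigma> v < w v"
    moreover have "interp \<sigma> v \<noteq> w v" using w_generic v \<sigma>(1) by (auto simp: N_def interp_def)
    ultimately have "w v < interp \<sigma> v" by simp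
    then show False using pivot[OF _ y(1) _ v] \<sigma> by (auto simp: N_def)
  qed
  then show ?thesis using \<sigma>(1) by (auto simp: N_def triangulation_def)
qed

lemma lex_inside_unique:
  assumes "generic s" "x \<in> span V" "\<sigma> \<in> triangulation" "\<sigma>' \<in> triangulation" "lex_inside s \<sigma> x" "lex_inside s \<sigma>' x"
  shows "\<sigma> = \<sigma>'"
proof -
  obtain \<epsilon> where \<epsilon>: "generic (x + \<epsilon> *\<^sub>R s)"
    "\<And>\<sigma>. \<sigma> \<in> bases \<Longrightarrow> (\<forall>j\<in>\<sigma>. 0 < rep \<sigma> (x + \<epsilon> *\<^sub>R s) j) \<longleftrightarrow> lex_inside s \<sigma> x"
    using perturb[OF assms(1,2)] by blast
  show ?thesis
    using \<epsilon> assms by (intro triangulation_unique[of \<sigma> \<sigma>' "x + \<epsilon> *\<^sub>R s"]) (auto simp: generic_def triangulation_bases)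
qed

end

section \<open>Half-open decomposition along a generic direction\<close>

locale generic_configuration = weighted_configuration +
  fixes q :: 'a
  assumes q_open: "q \<in> open_cone" and q_generic: "generic q"
begin

lemma generic_uminus: "generic (- q)"
proof -
  have "rep \<sigma> (- q) j = - rep \<sigma> q j" if "\<sigma> \<in> bases" for \<sigma> j
    using rep_scale[OF that, of q "-1"] q_generic by (simp add: generic_def)
  then show ?thesis using q_generic by (auto simp: generic_def span_neg)
qed

lemma rep_uminus: "\<sigma> \<in> bases \<Longrightarrow> rep \<sigma> (- q) j = - rep \<sigma> q j"
  using rep_scale[of \<sigma> q "-1"] q_generic by (simp add: generic_def)

text \<open>Adding a small multiple of \<open>q\<close> stays in the cone, and
  \<open>triangulation_exists\<close> applies to the pushed point, which is generic.\<close>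

lemma lex_inside_exists:
  assumes x: "x \<in> cone"
  shows "\<exists>\<sigma>\<in>triangulation. lex_inside q \<sigma> x"
proof -
  obtain \<epsilon> where \<epsilon>: "0 < \<epsilon>" "generic (x + \<epsilon> *\<^sub>R q)"
    "\<And>\<sigma>. \<sigma> \<in> bases \<Longrightarrow> (\<forall>j\<in>\<sigma>. 0 < rep \<sigma> (x + \<epsilon> *\<^sub>R q) j) \<longleftrightarrow> lex_inside q \<sigma> x"
    using perturb[OF q_generic cone_span[OF x]] by blast
  obtain a where a: "\<forall>v\<in>V. 0 \<le> a v" "x = (\<Sum>v\<in>V. a v *\<^sub>R v)" using x by (auto simp: cone_def)
  obtain b where b: "\<forall>v\<in>V. 0 < b v" "q = (\<Sum>v\<in>V. b v *\<^sub>R v)" using q_open by (auto simp: open_cone_def)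
  have "x + \<epsilon> *\<^sub>R q \<in> cone"
  proof (rule coneI[of V "\<lambda>v. a v + \<epsilon> * b v"])
    show "0 \<le> a v + \<epsilon> * b v" if "v \<in> V" for v using that a b \<epsilon>(1) by (simp add: less_imp_le)
    show "x + \<epsilon> *\<^sub>R q = (\<Sum>v\<in>V. (a v + \<epsilon> * b v) *\<^sub>R v)"
      by (simp add: a(2) b(2) scaleR_add_left sum.distrib scaleR_sum_right)
  qed simp
  then show ?thesis using triangulation_exists[OF \<epsilon>(2)] \<epsilon>(3) by (auto simp: triangulation_def)
qed

lemma lex_inside_cone:
  assumes "\<sigma> \<in> bases" "x \<in> span V" "lex_inside s \<sigma> x"
  shows "x \<in> cone"
  using assms rep_expand[OF assms(1,2)]
  by (intro coneI[of \<sigma> "rep \<sigma> x"]) (force simp: bases_def lex_inside_def lexpos_def)+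

text \<open>If \<open>x\<close> pushed along \<open>- q\<close> is still in the cone, adding the
  push back, a combination with all coefficients positive, puts \<open>x\<close> in the open
  cone.\<close>

lemma lex_inside_open_cone:
  assumes \<sigma>: "\<sigma> \<in> bases" and x: "x \<in> span V" and h: "lex_inside (- q) \<sigma> x"
  shows "x \<in> open_cone"
proof -
  obtain \<epsilon> where \<epsilon>: "0 < \<epsilon>" "generic (x + \<epsilon> *\<^sub>R - q)"
    "\<And>\<sigma>. \<sigma> \<in> bases \<Longrightarrow> (\<forall>j\<in>\<sigma>. 0 < rep \<sigma> (x + \<epsilon> *\<^sub>R - q) j) \<longleftrightarrow> lex_inside (- q) \<sigma> x"
    by (rule perturb[OF generic_uminus x]) (rule that)
  let ?y = "x + \<epsilon> *\<^sub>R - q"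
  have "?y \<in> span V" using x q_generic unfolding generic_def by (intro span_add span_scale span_neg) auto
  moreover have "\<forall>j\<in>\<sigma>. 0 < rep \<sigma> ?y j" using \<epsilon>(3)[OF \<sigma>] h by blast
  ultimately have "?y \<in> cone"
    using \<sigma> rep_expand[OF \<sigma>, of ?y] by (intro coneI[of \<sigma> "rep \<sigma> ?y"]) (auto simp: bases_def less_imp_le)
  then obtain a where a: "\<forall>v\<in>V. 0 \<le> a v" "?y = (\<Sum>v\<in>V. a v *\<^sub>R v)" by (auto simp: cone_def)
  obtain b where b: "\<forall>v\<in>V. 0 < b v" "q = (\<Sum>v\<in>V. b v *\<^sub>R v)" using q_open by (auto simp: open_cone_def)
  have "x = ?y + \<epsilon> *\<^sub>R q" by simp
  also have "\<dots> = (\<Sum>v\<in>V. (a v + \<epsilon> * b v) *\<^sub>R v)"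
    unfolding a(2) by (simp add: b(2) scaleR_add_left sum.distrib scaleR_sum_right)
  finally have "x = (\<Sum>v\<in>V. (a v + \<epsilon> * b v) *\<^sub>R v)" .
  then show ?thesis unfolding open_cone_def using a(1) b(1) \<epsilon>(1)
    by (intro CollectI exI[of _ "\<lambda>v. a v + \<epsilon> * b v"]) (auto intro: add_nonneg_pos)
qed

text \<open>A point on the facet opposite to such a \<open>j\<close> leaves the cone over
  \<open>\<sigma>\<close> when pushed along \<open>q\<close>, so that facet is removed.\<close>

definition excluded :: "'a set \<Rightarrow> 'a set" where
  "excluded \<sigma> = {j \<in> \<sigma>. rep \<sigma> q j < 0}"

abbreviation piece :: "'a set \<Rightarrow> 'a set \<Rightarrow> nat \<Rightarrow> 'a set" where
  "piece \<sigma> \<equiv> simplicial_lattice.half_open \<sigma> L (excluded \<sigma>)"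

lemma piece_cone:
  assumes \<sigma>: "\<sigma> \<in> bases"
  shows "piece \<sigma> {} n = {x \<in> L. lev x = real n \<and> lex_inside q \<sigma> x}"
proof -
  interpret simplicial_lattice \<sigma> L using \<sigma> by (rule basis_simplicial)
  have "(\<forall>e\<in>\<sigma>. if e \<in> excluded \<sigma> then 0 < coord x e else 0 \<le> coord x e) \<longleftrightarrow> lex_inside q \<sigma> x" for x
  proof -
    have "rep \<sigma> q j \<noteq> 0" if "j \<in> \<sigma>" for j using q_generic \<sigma> that by (auto simp: generic_def)
    then show ?thesis unfolding lex_inside_def excluded_def lexpos_def coord_def
      by (intro ball_cong) (auto simp: less_le)
  qed
  then show ?thesis using simplicial_hgt[OF \<sigma>] configuration.L_span[OF configuration_axioms]
    unfolding half_open_def by auto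
qed

lemma slice_partition:
  "slice n = (\<Union>\<sigma>\<in>triangulation. piece \<sigma> {} n)"
proof -
  have "x \<in> slice n \<longleftrightarrow> (\<exists>\<sigma>\<in>triangulation. x \<in> piece \<sigma> {} n)" for x
  proof
    assume "x \<in> slice n"
    then show "\<exists>\<sigma>\<in>triangulation. x \<in> piece \<sigma> {} n"
      using lex_inside_exists[of x] by (auto simp: slice_def piece_cone triangulation_bases)
  next
    assume "\<exists>\<sigma>\<in>triangulation. x \<in> piece \<sigma> {} n"
    then obtain \<sigma> where \<sigma>: "\<sigma> \<in> bases" "x \<in> L" "lev x = real n" "lex_inside q \<sigma> x"
      using piece_cone triangulation_bases by blast
    then have "x \<in> cone" using lex_inside_cone[of \<sigma> x q] L_span by auto
    then show "x \<in> slice n" using \<sigma> by (simp add: slice_def)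
  qed
  then show ?thesis by blast
qed

lemma finite_triangulation: "finite triangulation"
  using finite_bases by (simp add: triangulation_def)

lemma finite_piece: "\<sigma> \<in> bases \<Longrightarrow> finite (piece \<sigma> A n)"
  using simplicial_lattice.finite_half_open[OF basis_simplicial] .

lemma finite_slice: "finite (slice n)"
  unfolding slice_partition using finite_triangulation finite_piece triangulation_bases by blast

lemma card_slice:
  "card (slice n) = (\<Sum>\<sigma>\<in>triangulation. card (piece \<sigma> {} n))"
  unfolding slice_partition
proof (rule card_UN_disjoint[OF finite_triangulation])
  show "\<forall>\<sigma>\<in>triangulation. finite (piece \<sigma> {} n)" using finite_piece triangulation_bases by blast
  show "\<forall>\<sigma>\<in>triangulation. \<forall>\<sigma>'\<in>triangulation. \<sigma> \<noteq> \<sigma>' \<longrightarrow> piece \<sigma> {} n \<inter> piece \<sigma>' {} n = {}"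
  proof (intro ballI impI)
    fix \<sigma> \<sigma>' assume t: "\<sigma> \<in> triangulation" "\<sigma>' \<in> triangulation" "\<sigma> \<noteq> \<sigma>'"
    then show "piece \<sigma> {} n \<inter> piece \<sigma>' {} n = {}"
      using lex_inside_unique[OF q_generic _ t(1,2)] L_span by (auto simp: piece_cone triangulation_bases)
  qed
qed

lemma series_slice:
  "Abs_fps (\<lambda>n. int (card (slice n))) * (1 - fps_X) ^ dim V
    = (\<Sum>\<sigma>\<in>triangulation. Abs_fps (\<lambda>n. int (card (piece \<sigma> \<sigma> n))))"
proof -
  have "Abs_fps (\<lambda>n. int (card (slice n))) = (\<Sum>\<sigma>\<in>triangulation. Abs_fps (\<lambda>n. int (card (piece \<sigma> {} n))))"
    by (rule fps_ext) (simp add: card_slice fps_sum_nth)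
  then have "Abs_fps (\<lambda>n. int (card (slice n))) * (1 - fps_X) ^ dim V
    = (\<Sum>\<sigma>\<in>triangulation. Abs_fps (\<lambda>n. int (card (piece \<sigma> {} n))) * (1 - fps_X) ^ card \<sigma>)"
    by (simp add: sum_distrib_right basis_card triangulation_bases)
  also have "\<dots> = (\<Sum>\<sigma>\<in>triangulation. Abs_fps (\<lambda>n. int (card (piece \<sigma> \<sigma> n))))"
  proof (intro sum.cong refl)
    fix \<sigma> assume "\<sigma> \<in> triangulation"
    then interpret simplicial_lattice \<sigma> L using triangulation_bases basis_simplicial by blast
    show "Abs_fps (\<lambda>n. int (card (piece \<sigma> {} n))) * (1 - fps_X) ^ card \<sigma> = Abs_fps (\<lambda>n. int (card (piece \<sigma> \<sigma> n)))"
      using series_cone[of "excluded \<sigma>"] by (simp add: series_def)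
  qed
  finally show ?thesis .
qed

text \<open>Reflecting \<open>x\<close> to \<open>\<Sum>\<sigma> - x\<close> exchanges open and
  closed ends, turning the convention for \<open>q\<close> into that for \<open>- q\<close>. Images
  from different simplices are then distinct by \<open>lex_inside_unique\<close>, and all lie in the
  open cone at height 1.\<close>

lemma sum_card_box_le:
  assumes D: "0 < dim V"
  shows "(\<Sum>\<sigma>\<in>triangulation. card (piece \<sigma> \<sigma> (dim V - 1))) \<le> card {x \<in> L. x \<in> open_cone \<and> lev x = 1}"
proof -
  let ?Z = "Sigma triangulation (\<lambda>\<sigma>. piece \<sigma> \<sigma> (dim V - 1))"
  define F where "F = (\<lambda>(\<sigma>, x). \<Sum>\<sigma> - x :: 'a)"
  have F: "\<Sum>\<sigma> - x \<in> L \<and> lev (\<Sum>\<sigma> - x) = 1 \<and> lex_inside (- q) \<sigma> (\<Sum>\<sigma> - x)"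
    if t: "\<sigma> \<in> triangulation" and x: "x \<in> piece \<sigma> \<sigma> (dim V - 1)" for \<sigma> x
  proof -
    have \<sigma>: "\<sigma> \<in> bases" using t by (rule triangulation_bases)
    interpret S: simplicial_lattice \<sigma> L using \<sigma> by (rule basis_simplicial)
    have sub: "\<sigma> \<subseteq> L" using \<sigma> V_L by (auto simp: bases_def)
    have A: "\<Sum>\<sigma> \<in> L" using sub by (intro S.L_sum) auto
    have xL: "x \<in> L" "S.hgt x = real (dim V - 1)" using x by (auto simp: S.half_open_def)
    have cA: "S.coord (\<Sum>\<sigma>) j = 1" if "j \<in> \<sigma>" for j
      using sub that by (subst S.coord_sum) (auto simp: S.coord_basis S.finite_E)
    have cd: "S.coord (\<Sum>\<sigma> - x) j = 1 - S.coord x j" if "j \<in> \<sigma>" for j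
      using that A xL by (simp add: S.coord_diff cA)
    have "S.hgt (\<Sum>\<sigma> - x) = 1"
      using A xL D basis_card[OF \<sigma>] by (simp add: S.hgt_diff S.hgt_def[of "\<Sum>\<sigma>"] cA of_nat_diff)
    moreover have yL: "\<Sum>\<sigma> - x \<in> L" using A xL by (simp add: S.L_diff)
    ultimately have "lev (\<Sum>\<sigma> - x) = 1" using simplicial_hgt[OF \<sigma>, of "\<Sum>\<sigma> - x"] L_span by auto
    moreover have "lex_inside (- q) \<sigma> (\<Sum>\<sigma> - x)"
      unfolding lex_inside_def
    proof
      fix j assume j: "j \<in> \<sigma>"
      have nz: "rep \<sigma> q j \<noteq> 0" using q_generic \<sigma> j by (auto simp: generic_def)
      \<comment> \<open>An excluded coordinate may reach 1 and reflect to 0, but there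
        \<open>- q\<close> has a positive coordinate; the others stay strictly below 1.\<close>
      have b: "if j \<in> excluded \<sigma> then S.coord x j \<le> 1 else S.coord x j < 1" using x j by (auto simp: S.half_open_def)
      have "rep \<sigma> (\<Sum>\<sigma> - x) j = 1 - S.coord x j" using cd[OF j] by (simp add: S.coord_def)
      then show "lexpos (rep \<sigma> (\<Sum>\<sigma> - x) j) (rep \<sigma> (- q) j)"
        using b nz j unfolding rep_uminus[OF \<sigma>] by (auto simp: excluded_def lexpos_def split: if_splits)
    qed
    ultimately show ?thesis using yL by blast
  qed
  have "card ?Z \<le> card {x \<in> L. x \<in> open_cone \<and> lev x = 1}"
  proof (rule card_inj_on_le)
    show "inj_on F ?Z"
    proof (intro inj_onI, clarify)
      fix \<sigma> x \<tau> y assume a: "\<sigma> \<in> triangulation" "x \<in> piece \<sigma> \<sigma> (dim V - 1)"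
        "\<tau> \<in> triangulation" "y \<in> piece \<tau> \<tau> (dim V - 1)" "F (\<sigma>, x) = F (\<tau>, y)"
      then have eq: "\<Sum>\<sigma> - x = \<Sum>\<tau> - y" by (simp add: F_def)
      have "\<sigma> = \<tau>"
        using lex_inside_unique[OF generic_uminus _ a(1,3), of "\<Sum>\<sigma> - x"] F[OF a(1,2)] F[OF a(3,4)] L_span
        unfolding eq by auto
      then show "\<sigma> = \<tau> \<and> x = y" using eq by simp
    qed
    show "F ` ?Z \<subseteq> {x \<in> L. x \<in> open_cone \<and> lev x = 1}"
      using F lex_inside_open_cone triangulation_bases L_span by (fastforce simp: F_def)
    show "finite {x \<in> L. x \<in> open_cone \<and> lev x = 1}"
    proof (rule finite_subset[OF _ finite_slice[of 1]])
      show "{x \<in> L. x \<in> open_cone \<and> lev x = 1} \<subseteq> slice 1"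
        using open_cone_subset by (auto simp: slice_def)
    qed
  qed
  moreover have "card ?Z = (\<Sum>\<sigma>\<in>triangulation. card (piece \<sigma> \<sigma> (dim V - 1)))"
    using finite_triangulation finite_piece triangulation_bases by (simp add: card_SigmaI)
  ultimately show ?thesis by simp
qed

end

context configuration
begin

lemma series_coeff_le:
  assumes D: "0 < dim V"
  shows "(Abs_fps (\<lambda>n. int (card (slice n))) * (1 - fps_X) ^ dim V) $ (dim V - 1)
    \<le> int (card {x \<in> L. x \<in> open_cone \<and> lev x = 1})"
proof -
  \<comment> \<open>Each functional is the weight of \<open>v\<close> minus its interpolation over
    \<open>\<sigma>\<close>, as a function of the weights.\<close>
  define F1 where "F1 = (\<lambda>(\<sigma>, v) u. (if u = v then 1 else 0) - (if u \<in> \<sigma> then rep \<sigma> v u else 0)) ` Sigma bases (\<lambda>\<sigma>. V - \<sigma>)"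
  have "finite F1" unfolding F1_def using finite_bases finite_V by (intro finite_imageI finite_SigmaI) auto
  moreover have "\<exists>v\<in>V. f v \<noteq> 0" if "f \<in> F1" for f
    using that by (force simp: F1_def)
  ultimately obtain w where w: "\<forall>f\<in>F1. (\<Sum>v\<in>V. f v * w v) \<noteq> 0"
    using generic_weights[OF finite_V, of F1] by blast
  have W: "weighted_configuration V L lev w"
  proof unfold_locales
    fix \<sigma> v assume \<sigma>: "\<sigma> \<in> bases" and v: "v \<in> V - \<sigma>"
    let ?f = "\<lambda>u. (if u = v then 1 else 0) - (if u \<in> \<sigma> then rep \<sigma> v u else 0)"
    have "?f \<in> F1" unfolding F1_def using \<sigma> v by (intro image_eqI[of _ _ "(\<sigma>, v)"]) auto
    from bspec[OF w this] have "(\<Sum>u\<in>V. ?f u * w u) \<noteq> 0" .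
    moreover have "(\<Sum>u\<in>V. ?f u * w u) = w v - (\<Sum>j\<in>\<sigma>. rep \<sigma> v j * w j)"
    proof -
      have "(\<Sum>u\<in>V. ?f u * w u) = (\<Sum>u\<in>V. if u = v then w v else 0) - (\<Sum>u\<in>V. if u \<in> \<sigma> then rep \<sigma> v u * w u else 0)"
        unfolding sum_subtractf[symmetric] using v by (intro sum.cong) auto
      also have "(\<Sum>u\<in>V. if u \<in> \<sigma> then rep \<sigma> v u * w u else 0) = (\<Sum>j\<in>\<sigma>. rep \<sigma> v j * w j)"
        using \<sigma> finite_V by (simp add: sum.inter_restrict[symmetric] bases_def Int_absorb1)
      finally show ?thesis using v finite_V by (simp add: algebra_simps)
    qed
    ultimately show "(\<Sum>j\<in>\<sigma>. rep \<sigma> v j * w j) \<noteq> w v" by simp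
  qed
  \<comment> \<open>Each functional is a coordinate of \<open>q\<close> over
    \<open>\<sigma>\<close>, as a function of the weights \<open>\<tau>\<close> that define
    \<open>q\<close>.\<close>
  define F2 where "F2 = (\<lambda>(\<sigma>, j) v. rep \<sigma> v j) ` Sigma bases (\<lambda>\<sigma>. \<sigma>)"
  have "finite F2" unfolding F2_def using finite_bases basis_finite by (intro finite_imageI finite_SigmaI) auto
  moreover have "\<exists>v\<in>V. f v \<noteq> 0" if "f \<in> F2" for f
  proof -
    obtain \<sigma> j where "\<sigma> \<in> bases" "j \<in> \<sigma>" "f = (\<lambda>v. rep \<sigma> v j)" using \<open>f \<in> F2\<close> by (auto simp: F2_def)
    then show ?thesis by (intro bexI[of _ j]) (auto simp: bases_def representation_basis)
  qed
  ultimately obtain \<tau> where \<tau>: "\<forall>v\<in>V. 0 < \<tau> v" "\<forall>f\<in>F2. (\<Sum>v\<in>V. f v * \<tau> v) \<noteq> 0"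
    using generic_weights[OF finite_V, of F2] by blast
  define q where "q = (\<Sum>v\<in>V. \<tau> v *\<^sub>R v)"
  have "generic q"
    unfolding generic_def
  proof (intro conjI ballI)
    show "q \<in> span V" unfolding q_def by (intro span_sum span_scale span_base)
    fix \<sigma> j assume \<sigma>: "\<sigma> \<in> bases" and j: "j \<in> \<sigma>"
    have "rep \<sigma> q j = (\<Sum>v\<in>V. rep \<sigma> v j * \<tau> v)"
      unfolding q_def using \<sigma>
      by (subst representation_sum) (auto simp: bases_def representation_scale span_base span_scale mult.commute)
    moreover have "(\<lambda>v. rep \<sigma> v j) \<in> F2" unfolding F2_def using \<sigma> j by (intro image_eqI[of _ _ "(\<sigma>, j)"]) auto
    ultimately show "rep \<sigma> q j \<noteq> 0" using \<tau>(2) by auto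
  qed
  moreover have "q \<in> open_cone" using \<tau>(1) by (auto simp: open_cone_def q_def)
  ultimately interpret generic_configuration V L lev w q
    using W by (simp add: generic_configuration_def generic_configuration_axioms_def)
  show ?thesis
    using sum_card_box_le[OF D] unfolding series_slice by (simp add: fps_sum_nth flip: of_nat_sum)
qed

end

section \<open>Lattice polytopes\<close>

lemma full_lattice_closed:
  assumes "full_lattice M"
  shows "0 \<in> M" "\<And>x y. x \<in> M \<Longrightarrow> y \<in> M \<Longrightarrow> x + y \<in> M" "\<And>x y. x \<in> M \<Longrightarrow> y \<in> M \<Longrightarrow> x - y \<in> M"
proof -
  obtain B where M: "M = {\<Sum>b\<in>B. of_int (c b) *\<^sub>R b | c :: 'a \<Rightarrow> int. True}"
    using assms by (auto simp: full_lattice_def)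
  show "0 \<in> M" unfolding M by (intro CollectI exI[of _ "\<lambda>_. 0"]) simp
  fix x y assume "x \<in> M" "y \<in> M"
  then obtain f g :: "'a \<Rightarrow> int" where xy: "x = (\<Sum>b\<in>B. of_int (f b) *\<^sub>R b)" "y = (\<Sum>b\<in>B. of_int (g b) *\<^sub>R b)"
    unfolding M by blast
  show "x + y \<in> M" unfolding M xy
    by (intro CollectI exI[of _ "\<lambda>b. f b + g b"]) (simp add: scaleR_add_left sum.distrib)
  show "x - y \<in> M" unfolding M xy
    by (intro CollectI exI[of _ "\<lambda>b. f b - g b"]) (simp add: scaleR_diff_left sum_subtractf)
qed

text \<open>Linear coordinates are bounded on a bounded set, so only finitely many integer
  coordinate vectors occur.\<close>

lemma full_lattice_discrete:
  assumes M: "full_lattice M" and S: "bounded S"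
  shows "finite (M \<inter> S)"
proof -
  obtain B where B: "finite B" "independent B" "span B = UNIV"
      "M = {\<Sum>b\<in>B. of_int (c b) *\<^sub>R b | c :: 'a \<Rightarrow> int. True}"
    using M by (auto simp: full_lattice_def)
  let ?r = "representation B"
  have lin: "linear (\<lambda>x. ?r x b)" for b
    using B(2,3) by (intro linearI) (auto simp: representation_add representation_scale)
  have "\<exists>K. \<forall>x\<in>S. \<bar>?r x b\<bar> \<le> K" for b
    using bounded_linear_image[OF S, of "\<lambda>x. ?r x b"] lin[of b]
    by (force simp: linear_conv_bounded_linear bounded_iff)
  then obtain K where K: "\<And>b x. x \<in> S \<Longrightarrow> \<bar>?r x b\<bar> \<le> K b" by metis
  define C where "C = (\<Pi>\<^sub>E b\<in>B. {- \<lceil>K b\<rceil>..\<lceil>K b\<rceil>})"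
  have "M \<inter> S \<subseteq> (\<lambda>c. \<Sum>b\<in>B. of_int (c b) *\<^sub>R b) ` C"
  proof
    fix x assume x: "x \<in> M \<inter> S"
    then obtain f :: "'a \<Rightarrow> int" where f: "x = (\<Sum>b\<in>B. of_int (f b) *\<^sub>R b)" using B(4) by auto
    have "f b \<in> {- \<lceil>K b\<rceil>..\<lceil>K b\<rceil>}" if "b \<in> B" for b
    proof -
      have "?r x b = of_int (f b)" unfolding f using representation_sum_scale[OF B(2) that] .
      then have "\<bar>of_int (f b) :: real\<bar> \<le> K b" using K x by (metis IntD2)
      then show ?thesis by (auto simp: abs_le_iff) linarith+
    qed
    then have "restrict f B \<in> C" by (auto simp: C_def)
    moreover have "x = (\<Sum>b\<in>B. of_int (restrict f B b) *\<^sub>R b)" using f by simp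
    ultimately show "x \<in> (\<lambda>c. \<Sum>b\<in>B. of_int (c b) *\<^sub>R b) ` C" by blast
  qed
  moreover have "finite C" unfolding C_def using B(1) by (intro finite_PiE) auto
  ultimately show ?thesis using finite_subset by blast
qed

section \<open>Homogenization of a polytope\<close>

definition lift :: "'a::euclidean_space \<Rightarrow> 'a \<times> real" where
  "lift x = (x, 1)"

lemma fst_lift [simp]: "fst (lift x) = x" and snd_lift [simp]: "snd (lift x) = 1"
  by (simp_all add: lift_def)

text \<open>Intersecting with the span covers polytopes that are not full-dimensional.\<close>

definition lifted :: "'a::euclidean_space set \<Rightarrow> 'a set \<Rightarrow> ('a \<times> real) set" where
  "lifted M V = (M \<times> \<int>) \<inter> span (lift ` V)"

lemma inj_lift: "inj_on lift A"
  by (auto simp: inj_on_def lift_def)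

lemma sum_lift: "(\<Sum>v\<in>lift ` A. a v *\<^sub>R v) = (\<Sum>v\<in>A. a (lift v) *\<^sub>R v, \<Sum>v\<in>A. a (lift v))"
  by (simp add: sum.reindex[OF inj_lift] o_def prod_eq_iff fst_sum snd_sum)

lemma sum_lift': "(\<Sum>v\<in>A. a v *\<^sub>R lift v) = (\<Sum>v\<in>A. a v *\<^sub>R v, \<Sum>v\<in>A. a v)"
  by (simp add: prod_eq_iff fst_sum snd_sum)

text \<open>Stated for a predicate so as to cover \<open>cone\<close> and \<open>open_cone\<close>
  alike.\<close>

lemma lift_coeffs: "(\<exists>a. (\<forall>v\<in>lift ` V. P (a v)) \<and> x = (\<Sum>v\<in>lift ` V. a v *\<^sub>R v))
    \<longleftrightarrow> (\<exists>a. (\<forall>v\<in>V. P (a v)) \<and> fst x = (\<Sum>v\<in>V. a v *\<^sub>R v) \<and> snd x = (\<Sum>v\<in>V. a v))" (is "?A \<longleftrightarrow> ?B")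
proof
  assume ?A
  then obtain a where "\<forall>v\<in>lift ` V. P (a v)" "x = (\<Sum>v\<in>lift ` V. a v *\<^sub>R v)" by blast
  then show ?B by (intro exI[of _ "a \<circ> lift"]) (simp add: sum_lift)
next
  assume ?B
  then obtain a where "\<forall>v\<in>V. P (a v)" "fst x = (\<Sum>v\<in>V. a v *\<^sub>R v)" "snd x = (\<Sum>v\<in>V. a v)" by blast
  then show ?A by (intro exI[of _ "a \<circ> fst"]) (simp add: sum_lift prod_eq_iff)
qed

lemma independent_lift:
  assumes "\<not> affine_dependent V"
  shows "independent (lift ` V)"
proof
  have fin: "finite V" using assms aff_independent_finite by blast
  assume "dependent (lift ` V)"
  then obtain u where u: "\<exists>v\<in>lift ` V. u v \<noteq> 0" "(\<Sum>v\<in>lift ` V. u v *\<^sub>R v) = 0"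
    using fin by (auto simp: dependent_finite)
  then have "(\<Sum>v\<in>V. u (lift v)) = 0" "\<exists>v\<in>V. u (lift v) \<noteq> 0" "(\<Sum>v\<in>V. u (lift v) *\<^sub>R v) = 0"
    by (auto simp: sum_lift prod_eq_iff)
  then have "affine_dependent V" using affine_dependent_explicit_finite[OF fin] by blast
  then show False using assms by blast
qed

lemma dim_lift:
  assumes "finite V"
  shows "int (dim (lift ` V)) = aff_dim V + 1"
proof -
  obtain B where B: "B \<subseteq> V" "\<not> affine_dependent B" "affine hull V = affine hull B"
    using affine_basis_exists by blast
  have fin: "finite B" using B(1) assms finite_subset by blast
  have "lift ` V \<subseteq> span (lift ` B)"
  proof (intro image_subsetI)
    fix v assume "v \<in> V"
    then have "v \<in> affine hull B" using B(3) hull_inc by metis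
    then obtain u where "sum u B = 1" "(\<Sum>v\<in>B. u v *\<^sub>R v) = v" using affine_hull_finite[OF fin] by auto
    then have "lift v = (\<Sum>b\<in>B. u b *\<^sub>R lift b)" unfolding sum_lift' by (simp add: lift_def)
    then show "lift v \<in> span (lift ` B)" by (auto intro!: span_sum span_scale intro: span_base)
  qed
  then have "dim (lift ` V) = card (lift ` B)"
    using independent_lift[OF B(2)] B(1) by (intro dim_unique[of "lift ` B"]) auto
  also have "card (lift ` B) = card B" by (rule card_image[OF inj_lift])
  also have "int (card B) = aff_dim V + 1"
    using B(2,3) affine_independent_iff_card[of B] by (metis aff_dim_affine_hull diff_add_cancel)
  finally show ?thesis .
qed

lemma lift_configuration:
  assumes M: "full_lattice M" and V: "finite V" "V \<subseteq> M"
  shows "configuration (lift ` V) (lifted M V) snd"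
proof (rule configuration.intro)
  show "finite (lift ` V)" using V by simp
  show "lift ` V \<subseteq> lifted M V" using V by (auto simp: lifted_def lift_def intro!: span_base)
  show "lifted M V \<subseteq> span (lift ` V)" by (auto simp: lifted_def)
  show "0 \<in> lifted M V" using full_lattice_closed[OF M] by (auto simp: lifted_def zero_prod_def[symmetric] span_zero simp flip: zero_prod_def) (simp_all add: zero_prod_def)
  show "x + y \<in> lifted M V" "x - y \<in> lifted M V" if "x \<in> lifted M V" "y \<in> lifted M V" for x y
    using that full_lattice_closed[OF M] unfolding lifted_def
    by (auto simp: mem_Times_iff intro: span_add span_diff)
  show "finite (lifted M V \<inter> S)" if S: "bounded S" for S
  proof -
    have 1: "finite (M \<inter> fst ` S)" by (rule full_lattice_discrete[OF M bounded_fst[OF S]])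
    have "bounded (snd ` S)" by (rule bounded_snd[OF S])
    then obtain K where "\<forall>r\<in>snd ` S. \<bar>r\<bar> \<le> K" by (auto simp: bounded_iff)
    then have "\<int> \<inter> snd ` S \<subseteq> {r \<in> \<int>. \<bar>r\<bar> \<le> K}" by auto
    moreover have "finite {r::real. r \<in> \<int> \<and> \<bar>r\<bar> \<le> K}" by (rule finite_abs_int_segment)
    ultimately have "finite (\<int> \<inter> snd ` S)" by (rule finite_subset)
    then have "finite ((M \<inter> fst ` S) \<times> (\<int> \<inter> snd ` S))" using 1 by blast
    moreover have "lifted M V \<inter> S \<subseteq> (M \<inter> fst ` S) \<times> (\<int> \<inter> snd ` S)"
      by (auto simp: lifted_def intro: rev_image_eqI)
    ultimately show ?thesis by (rule finite_subset[rotated])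
  qed
  show "linear (snd :: 'a \<times> real \<Rightarrow> real)" by (rule linear_snd)
  show "snd v = 1" if "v \<in> lift ` V" for v using that by (auto simp: lift_def)
qed

lemma mem_cone_lift:
  assumes "full_lattice M" "finite V" "V \<subseteq> M" "V \<noteq> {}"
  shows "(x, real n) \<in> configuration.cone (lift ` V) \<longleftrightarrow> x \<in> dilate n (convex hull V)"
proof -
  interpret configuration "lift ` V" "lifted M V" snd using assms by (intro lift_configuration)
  have "(x, real n) \<in> cone \<longleftrightarrow>
      (\<exists>a. (\<forall>v\<in>V. 0 \<le> a v) \<and> x = (\<Sum>v\<in>V. a v *\<^sub>R v) \<and> real n = (\<Sum>v\<in>V. a v))"
    unfolding cone_def mem_Collect_eq using lift_coeffs[of V "\<lambda>r. 0 \<le> r" "(x, real n)"] by simp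
  also have "\<dots> \<longleftrightarrow> x \<in> dilate n (convex hull V)"
  proof
    assume "\<exists>a. (\<forall>v\<in>V. 0 \<le> a v) \<and> x = (\<Sum>v\<in>V. a v *\<^sub>R v) \<and> real n = (\<Sum>v\<in>V. a v)"
    then obtain a where a: "\<forall>v\<in>V. 0 \<le> a v" "x = (\<Sum>v\<in>V. a v *\<^sub>R v)" "real n = (\<Sum>v\<in>V. a v)" by blast
    show "x \<in> dilate n (convex hull V)"
    proof (cases "n = 0")
      case True
      then have "\<forall>v\<in>V. a v = 0" using a sum_nonneg_eq_0_iff[OF assms(2), of a] by auto
      \<comment> \<open>The zeroth dilate is {0}, reached from any point of the hull;
        \<open>V \<noteq> {}\<close> provides one.\<close>
      then have "x = real n *\<^sub>R (SOME v. v \<in> V)" using a True by simp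
      moreover have "(SOME v. v \<in> V) \<in> convex hull V" using assms(4) by (simp add: hull_inc some_in_eq)
      ultimately show ?thesis unfolding dilate_def by blast
    next
      case False
      define y where "y = (\<Sum>v\<in>V. (a v / real n) *\<^sub>R v)"
      have "y \<in> convex hull V" unfolding convex_hull_finite[OF assms(2)] mem_Collect_eq
        using a False by (intro exI[of _ "\<lambda>v. a v / real n"]) (auto simp: y_def sum_divide_distrib[symmetric])
      moreover have "x = real n *\<^sub>R y" using a False by (simp add: y_def scaleR_sum_right)
      ultimately show ?thesis unfolding dilate_def by blast
    qed
  next
    assume "x \<in> dilate n (convex hull V)"
    then obtain u where u: "\<forall>v\<in>V. 0 \<le> u v" "sum u V = 1" "x = real n *\<^sub>R (\<Sum>v\<in>V. u v *\<^sub>R v)"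
      unfolding dilate_def convex_hull_finite[OF assms(2)] by blast
    then show "\<exists>a. (\<forall>v\<in>V. 0 \<le> a v) \<and> x = (\<Sum>v\<in>V. a v *\<^sub>R v) \<and> real n = (\<Sum>v\<in>V. a v)"
      by (intro exI[of _ "\<lambda>v. real n * u v"]) (simp add: scaleR_sum_right sum_distrib_left[symmetric])
  qed
  finally show ?thesis .
qed

lemma slice_lift:
  assumes "full_lattice M" "finite V" "V \<subseteq> M" "V \<noteq> {}"
  shows "configuration.slice (lift ` V) (lifted M V) snd n = (\<lambda>x. (x, real n)) ` (dilate n (convex hull V) \<inter> M)"
proof -
  interpret configuration "lift ` V" "lifted M V" snd using assms by (intro lift_configuration)
  have "(x, r) \<in> slice n \<longleftrightarrow> r = real n \<and> x \<in> dilate n (convex hull V) \<inter> M" for x r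
    using mem_cone_lift[OF assms, of x n] cone_span[of "(x, real n)"]
    unfolding slice_def by (auto simp: lifted_def)
  then show ?thesis by auto
qed

lemma card_slice_lift:
  assumes "full_lattice M" "finite V" "V \<subseteq> M" "V \<noteq> {}"
  shows "card (configuration.slice (lift ` V) (lifted M V) snd n) = card (dilate n (convex hull V) \<inter> M)"
  unfolding slice_lift[OF assms] by (rule card_image) (simp add: inj_on_def)

lemma hstar_lift:
  assumes "full_lattice M" "finite V" "V \<subseteq> M" "V \<noteq> {}"
  shows "hstar M (convex hull V) =
    Abs_fps (\<lambda>n. int (card (configuration.slice (lift ` V) (lifted M V) snd n))) * (1 - fps_X) ^ dim (lift ` V)"
proof -
  have "0 \<le> aff_dim V" using assms(4) aff_dim_geq[of V] aff_dim_empty[of V] by linarith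
  then have "nat (aff_dim (convex hull V)) + 1 = dim (lift ` V)"
    using dim_lift[OF assms(2)] by (simp add: aff_dim_convex_hull)
  then show ?thesis by (simp add: hstar_def ehrhart_series_def card_slice_lift[OF assms])
qed

section \<open>Interior lattice points and cleanness\<close>

text \<open>The homogenization has dimension \<open>d + 1\<close>, so \<open>series_coeff_le\<close>
  concerns coefficient \<open>d\<close>. Its points are convex combinations with positive weight on
  all of \<open>V\<close>, hence relatively interior.\<close>

lemma hstar_top_le_interior:
  assumes "full_lattice M" "finite V" "V \<subseteq> M" "V \<noteq> {}" and d: "aff_dim (convex hull V) = int d"
  shows "hstar_coeff M (convex hull V) d \<le> int (card (rel_interior (convex hull V) \<inter> M))"
proof -
  interpret configuration "lift ` V" "lifted M V" snd using assms by (intro lift_configuration)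
  have dim: "dim (lift ` V) = d + 1"
    using dim_lift[OF assms(2)] d by (simp add: aff_dim_convex_hull)
  have "hstar_coeff M (convex hull V) d \<le> int (card {x \<in> lifted M V. x \<in> open_cone \<and> snd x = 1})"
    using series_coeff_le unfolding hstar_coeff_def hstar_lift[OF assms(1-4)] dim by simp
  moreover have "card {x \<in> lifted M V. x \<in> open_cone \<and> snd x = 1} \<le> card (rel_interior (convex hull V) \<inter> M)"
  proof (rule card_inj_on_le[of fst])
    show "inj_on fst {x \<in> lifted M V. x \<in> open_cone \<and> snd x = 1}" by (auto simp: inj_on_def)
    show "fst ` {x \<in> lifted M V. x \<in> open_cone \<and> snd x = 1} \<subseteq> rel_interior (convex hull V) \<inter> M"
    proof (rule image_subsetI)
      fix x assume x: "x \<in> {x \<in> lifted M V. x \<in> open_cone \<and> snd x = 1}"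
      then obtain a where a: "\<forall>v\<in>V. 0 < a v" "fst x = (\<Sum>v\<in>V. a v *\<^sub>R v)" "(\<Sum>v\<in>V. a v) = 1"
        using lift_coeffs[of V "\<lambda>r. 0 < r" x] unfolding open_cone_def by auto
      then have "fst x \<in> rel_interior (convex hull V)"
        by (intro subsetD[OF explicit_subset_rel_interior_convex_hull_minimal[OF assms(2)]] CollectI exI[of _ a]) simp
      then show "fst x \<in> rel_interior (convex hull V) \<inter> M" using x by (auto simp: lifted_def)
    qed
    have "bounded (rel_interior (convex hull V))"
      using assms(2) by (meson bounded_convex_hull bounded_subset finite_imp_bounded rel_interior_subset)
    then show "finite (rel_interior (convex hull V) \<inter> M)"
      unfolding Int_commute[of _ M] by (rule full_lattice_discrete[OF assms(1)])
  qed
  ultimately show ?thesis by linarith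
qed

lemma fps_mult_one_minus_X_power_nth:
  fixes F :: "int fps"
  shows "(F * (1 - fps_X) ^ k) $ 0 = F $ 0" "(F * (1 - fps_X) ^ k) $ 1 = F $ 1 - int k * F $ 0"
proof -
  have "(F * (1 - fps_X) ^ k) $ 0 = F $ 0 \<and> (F * (1 - fps_X) ^ k) $ 1 = F $ 1 - int k * F $ 0"
  proof (induction k)
    case (Suc k)
    have "F * (1 - fps_X) ^ Suc k = F * (1 - fps_X) ^ k - fps_X * (F * (1 - fps_X) ^ k)"
      by (simp add: algebra_simps)
    then show ?case using Suc by (simp add: algebra_simps)
  qed simp
  then show "(F * (1 - fps_X) ^ k) $ 0 = F $ 0" "(F * (1 - fps_X) ^ k) $ 1 = F $ 1 - int k * F $ 0"
    by blast+
qed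

lemma hstar_1:
  assumes "full_lattice M" "P \<noteq> {}" "aff_dim P = int d"
  shows "hstar_coeff M P 0 = 1" "hstar_coeff M P 1 = int (card (P \<inter> M)) - int d - 1"
proof -
  have "dilate 0 P \<inter> M = {0}" using assms(2) full_lattice_closed(1)[OF assms(1)] by (auto simp: dilate_def)
  moreover have "dilate 1 P = P" by (simp add: dilate_def)
  ultimately show "hstar_coeff M P 0 = 1" "hstar_coeff M P 1 = int (card (P \<inter> M)) - int d - 1"
    unfolding hstar_coeff_def hstar_def fps_mult_one_minus_X_power_nth
    by (simp_all add: ehrhart_series_def assms(3))
qed

lemma clean_of_hstar:
  assumes M: "full_lattice M" and P: "lattice_polytope M P" and d: "aff_dim P = int d" "1 \<le> d"
    and h: "hstar_coeff M P 1 = hstar_coeff M P d"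
  shows "clean_simplex M P"
proof -
  obtain V where V: "finite V" "V \<subseteq> M" "P = convex hull V" using P by (auto simp: lattice_polytope_def)
  have ne: "V \<noteq> {}" "P \<noteq> {}" using d V by auto
  have cpt: "compact P" unfolding V(3) using V(1) by (simp add: finite_imp_compact_convex_hull)
  have cvx: "convex P" unfolding V(3) by (rule convex_convex_hull)
  have finPM: "finite (P \<inter> M)"
    using full_lattice_discrete[OF M compact_imp_bounded[OF cpt]] by (simp add: Int_commute)
  have fr: "rel_frontier P = P - rel_interior P"
    using compact_imp_closed[OF cpt] by (simp add: rel_frontier_def)
  have "int (card (P \<inter> M)) - int d - 1 \<le> int (card (rel_interior P \<inter> M))"
    using hstar_top_le_interior[OF M V(1,2) ne(1)] h hstar_1(2)[OF M ne(2) d(1)] d(1) V(3) by simp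
  moreover have "card (P \<inter> M) = card (rel_interior P \<inter> M) + card (rel_frontier P \<inter> M)"
  proof -
    have "P \<inter> M = (rel_interior P \<inter> M) \<union> (rel_frontier P \<inter> M)"
      using rel_interior_subset[of P] fr by auto
    moreover have "finite (rel_interior P \<inter> M)" "finite (rel_frontier P \<inter> M)"
      using finPM rel_interior_subset[of P] fr by (auto elim: finite_subset[rotated])
    ultimately show ?thesis using fr by (auto intro: card_Un_disjoint)
  qed
  ultimately have le: "card (rel_frontier P \<inter> M) \<le> d + 1" by linarith
  have sub: "vertices P \<subseteq> rel_frontier P \<inter> M"
  proof
    fix v assume "v \<in> vertices P"
    then have v: "v extreme_point_of P" by (simp add: vertices_def)
    \<comment> \<open>A singleton would be its own relative interior; \<open>d \<ge> 1\<close>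
      excludes it.\<close>
    have "P \<noteq> {v}" using d by auto
    then have "v \<notin> rel_interior P" using extreme_point_not_in_REL_INTERIOR[OF v] by blast
    moreover have "v \<in> P" using v by (simp add: extreme_point_of_def)
    moreover have "v \<in> V" using v extreme_point_of_convex_hull unfolding V(3) by blast
    ultimately show "v \<in> rel_frontier P \<inter> M" using fr V(2) by auto
  qed
  have fin: "finite (rel_frontier P \<inter> M)" using finPM fr by (auto elim: finite_subset[rotated])
  have hull: "P = convex hull (vertices P)"
    using Krein_Milman_Minkowski[OF cpt cvx] by (simp add: vertices_def)
  have "aff_dim P \<le> int (card (vertices P)) - 1"
    using aff_dim_le_card[OF finite_subset[OF sub fin]] hull by (metis aff_dim_convex_hull)
  then have ge: "d + 1 \<le> card (vertices P)" using d by linarith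
  have "card (vertices P) \<le> card (rel_frontier P \<inter> M)" using card_mono[OF fin sub] .
  then have card: "card (vertices P) = d + 1" using ge le by linarith
  have "vertices P = rel_frontier P \<inter> M"
    using card_seteq[OF fin sub] le card by simp
  then show ?thesis
    using P card d by (simp add: clean_simplex_def lattice_simplex_def)
qed

section \<open>Unimodality for clean simplices\<close>

lemma unimodal_uptoI:
  fixes a :: "nat \<Rightarrow> int"
  assumes up: "\<And>i. i < k \<Longrightarrow> a i \<le> a (i + 1)"
    and down: "\<And>i. k \<le> i \<Longrightarrow> i < d \<Longrightarrow> a (i + 1) \<le> a i" and k: "k \<le> d"
  shows "unimodal_upto d a"
  unfolding unimodal_upto_def
proof (intro exI[of _ k] conjI monotone_onI)
  fix x y assume xy: "x \<in> {0..k}" "y \<in> {0..k}" "x \<le> y"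
  from xy(3,2) show "a x \<le> a y"
  proof (induction y rule: dec_induct)
    case (step n)
    then show ?case using up[of n] by simp
  qed simp
next
  fix x y assume xy: "x \<in> {k..d}" "y \<in> {k..d}" "x \<le> y"
  from xy(3,2) show "a y \<le> a x"
  proof (induction y rule: dec_induct)
    case (step n)
    then show ?case using down[of n] xy(1) by simp
  qed simp
qed (rule k)

text \<open>A simplex is a single closed cone after homogenization, so \<open>series_cone\<close>
  with nothing removed identifies \<open>hstar\<close> with the box counts.\<close>

lemma idp_simplex_of_clean:
  assumes M: "full_lattice M" and P: "clean_simplex M P" and idp: "IDP M P"
  shows "idp_simplex (lift ` vertices P) (lifted M (vertices P))"
    and "\<And>i. hstar_coeff M P i =
      int (card (simplicial_lattice.half_open (lift ` vertices P) (lifted M (vertices P)) {} (lift ` vertices P) i))"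
    and "int (card (lift ` vertices P)) = aff_dim P + 1"
proof -
  define V where "V = vertices P"
  obtain V0 where V0: "finite V0" "V0 \<subseteq> M" "P = convex hull V0"
    using P by (auto simp: clean_simplex_def lattice_simplex_def lattice_polytope_def)
  have VV: "V \<subseteq> V0" unfolding V_def vertices_def V0(3) using extreme_point_of_convex_hull by blast
  have V: "finite V" "V \<subseteq> M" using VV V0 finite_subset by auto
  have cpt: "compact P" unfolding V0(3) using V0(1) by (simp add: finite_imp_compact_convex_hull)
  have cvx: "convex P" unfolding V0(3) by (rule convex_convex_hull)
  have PV: "P = convex hull V"
    using Krein_Milman_Minkowski[OF cpt cvx] by (simp add: V_def vertices_def)
  have cardV: "int (card V) = aff_dim P + 1" and pos: "0 < aff_dim P" and fr: "rel_frontier P \<inter> M = V"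
    using P by (auto simp: clean_simplex_def lattice_simplex_def V_def)
  have ne: "V \<noteq> {}" using pos PV by auto
  have ai: "\<not> affine_dependent V"
    using cardV V(1) PV affine_independent_iff_card[of V] by (simp add: aff_dim_convex_hull)
  let ?E = "lift ` V" and ?L = "lifted M V"
  interpret configuration ?E ?L snd using M V by (rule lift_configuration)
  have Eb: "?E \<in> bases" using independent_lift[OF ai] by (simp add: bases_def)
  have cardE: "card ?E = card V" by (rule card_image[OF inj_lift])
  show "int (card (lift ` vertices P)) = aff_dim P + 1"
    using cardV cardE by (simp add: V_def)
  interpret S: simplicial_lattice ?E ?L using Eb by (rule basis_simplicial)
  have slice: "S.half_open {} {} n = slice n" for n
  proof -
    have "(\<forall>e\<in>?E. 0 \<le> S.coord x e) \<longleftrightarrow> x \<in> cone" if x: "x \<in> ?L" for x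
    proof
      assume "\<forall>e\<in>?E. 0 \<le> S.coord x e"
      then show "x \<in> cone" using S.expand[OF x] by (intro coneI[of ?E "S.coord x"]) auto
    next
      assume "x \<in> cone"
      then obtain a where a: "\<forall>e\<in>?E. 0 \<le> a e" "x = (\<Sum>e\<in>?E. a e *\<^sub>R e)" unfolding cone_def by blast
      show "\<forall>e\<in>?E. 0 \<le> S.coord x e"
        using a(1) representation_sum_scale[OF S.indep, of _ a] by (simp add: S.coord_def a(2))
    qed
    then show ?thesis
      using simplicial_hgt[OF Eb] L_span by (auto simp: S.half_open_def slice_def)
  qed
  have dim: "dim ?E = card ?E" using basis_card[OF Eb] by simp
  show "hstar_coeff M P i =
      int (card (simplicial_lattice.half_open (lift ` vertices P) (lifted M (vertices P)) {} (lift ` vertices P) i))" for i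
    using S.series_cone[of "{}"] hstar_lift[OF M V ne]
    by (simp add: hstar_coeff_def PV[symmetric] S.series_def slice dim V_def[symmetric])
  \<comment> \<open>By cleanness a lattice point of \<open>P\<close> that is no vertex is interior,
    so its barycentric coordinates are positive.\<close>
  have coord_lift: "S.coord (lift y) e > 0"
    if y: "y \<in> P \<inter> M" "y \<notin> V" and e: "e \<in> ?E" for y e
  proof -
    have "y \<in> rel_interior P"
      using y fr compact_imp_closed[OF cpt] by (auto simp: rel_frontier_def)
    then obtain u where u: "\<forall>v\<in>V. 0 < u v" "sum u V = 1" "(\<Sum>v\<in>V. u v *\<^sub>R v) = y"
      using rel_interior_convex_hull_explicit[OF ai] PV by auto
    have "lift y = (\<Sum>e\<in>?E. u (fst e) *\<^sub>R e)"
      unfolding sum_lift using u by (simp add: lift_def)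
    then have "S.coord (lift y) e = u (fst e)"
      using representation_sum_scale[OF S.indep e, of "u \<circ> fst"] by (simp add: S.coord_def)
    then show ?thesis using u(1) e by auto
  qed
  have gen: "\<exists>y. (\<forall>k<n. y k \<in> S.half_open {} ?E 1 \<and> (\<forall>e\<in>?E. 0 < S.coord (y k) e)) \<and> x = (\<Sum>k<n. y k)"
    if x: "x \<in> S.half_open {} ?E n" and n: "0 < n" for x n
  proof -
    have "x \<in> S.half_open {} {} n" using x by (auto simp: S.half_open_def)
    then have "x \<in> slice n" by (simp add: slice)
    then obtain z where z: "z \<in> dilate n P \<inter> M" "x = (z, real n)"
      using slice_lift[OF M V ne] PV by auto
    then obtain y where y: "\<forall>i<n. y i \<in> P \<inter> M" "z = (\<Sum>i<n. y i)"
      using idp n unfolding IDP_def by blast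
    have xs: "x = (\<Sum>i<n. lift (y i))"
      by (simp add: z(2) y(2) prod_eq_iff fst_sum snd_sum)
    have yb: "lift (y i) \<in> S.half_open {} {} 1" if "i < n" for i
      unfolding slice slice_lift[OF M V ne] using y(1) that by (auto simp: PV dilate_def lift_def)
    then have yL: "lift (y i) \<in> ?L" if "i < n" for i using that by (auto simp: S.half_open_def)
    \<comment> \<open>The summands have nonnegative coordinates, so each is bounded by the total,
      which is below 1 for a box point.\<close>
    have lt: "S.coord (lift (y i)) e < 1" if i: "i < n" and e: "e \<in> ?E" for i e
    proof -
      have "S.coord (lift (y i)) e \<le> (\<Sum>j<n. S.coord (lift (y j)) e)"
        using i e S.half_open_nonneg[OF yb] by (intro member_le_sum) auto
      also have "\<dots> = S.coord x e" unfolding xs using yL by (intro S.coord_sum[symmetric]) auto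
      also have "\<dots> < 1" using x e by (auto simp: S.half_open_def)
      finally show ?thesis .
    qed
    \<comment> \<open>A vertex would have coordinate 1 at itself.\<close>
    have "y i \<notin> V" if "i < n" for i
    proof
      assume "y i \<in> V"
      then show False using lt[OF that, of "lift (y i)"] S.coord_basis[of "lift (y i)" "lift (y i)"] by simp
    qed
    then have "\<forall>e\<in>?E. 0 < S.coord (lift (y i)) e" if "i < n" for i using coord_lift y(1) that by blast
    moreover have "lift (y i) \<in> S.half_open {} ?E 1" if "i < n" for i
      using yb[OF that] lt[OF that] by (auto simp: S.half_open_def)
    ultimately show ?thesis using xs by (intro exI[of _ "\<lambda>i. lift (y i)"]) auto
  qed
  have "idp_simplex ?E ?L"
  proof unfold_locales
    show "\<exists>y. (\<forall>k<n. y k \<in> S.half_open {} ?E 1) \<and> x = (\<Sum>k<n. y k)"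
      if "x \<in> S.half_open {} ?E n" "0 < n" for x n
      using gen[OF that] by blast
    show "0 < S.coord x e" if x: "x \<in> S.half_open {} ?E n" "0 < n" and e: "e \<in> ?E" for x n e
    proof -
      obtain y where y: "\<forall>k<n. y k \<in> S.half_open {} ?E 1 \<and> (\<forall>e\<in>?E. 0 < S.coord (y k) e)" "x = (\<Sum>k<n. y k)"
        using gen[OF x] by blast
      have "S.coord x e = (\<Sum>k<n. S.coord (y k) e)"
        unfolding y(2) using y(1) by (intro S.coord_sum) (auto simp: S.half_open_def)
      also have "\<dots> > 0" using y(1) e x(2) by (intro sum_pos) auto
      finally show ?thesis .
    qed
  qed
  then show "idp_simplex (lift ` vertices P) (lifted M (vertices P))" by (simp add: V_def)
qed

theorem corollary5p3:
  fixes M P :: "'a::euclidean_space set" and d :: nat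
  assumes "full_lattice M"
    and "lattice_polytope M P"
    and "aff_dim P = int d"
    and "d \<ge> 1"
    and "IDP M P"
    and "hstar_coeff M P 1 = hstar_coeff M P d"
  shows "clean_simplex M P \<and> unimodal_upto d (hstar_coeff M P)"
proof
  show clean: "clean_simplex M P"
    using assms by (intro clean_of_hstar)
  let ?E = "lift ` vertices P" and ?L = "lifted M (vertices P)"
  note S = idp_simplex_of_clean[OF assms(1) clean assms(5)]
  interpret idp_simplex ?E ?L by (rule S(1))
  define h where "h = hstar_coeff M P"
  have hb: "h i = int (card (box i))" for i unfolding h_def by (rule S(2))
  have cE: "card ?E = d + 1" using S(3) assms(3) by simp
  have h0: "h 0 = 1" unfolding h_def using assms by (intro hstar_1) auto
  have h1: "0 \<le> h 1" by (simp add: hb)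
  have "unimodal_upto d h"
  proof (cases "h 1 = 0")
    case True
    then have "box 1 = {}" by (simp add: hb)
    \<comment> \<open>By \<open>box_gen\<close> any higher box point would need summands in
      \<open>box 1\<close>; the vector is then 1, 0, ..., 0.\<close>
    then have "box i = {}" if "0 < i" for i
      using box_gen[of _ i] that by blast
    then have "h i = 0" if "0 < i" for i using that by (simp add: hb)
    moreover have "h (i + 1) \<le> h i" for i
      using calculation h0 by (cases "i = 0") auto
    ultimately show ?thesis by (intro unimodal_uptoI[of 0]) auto
  next
    case False
    have sym: "h (d + 1 - i) = h i" if "1 \<le> i" "i \<le> d" for i
      using card_box_reflect[of i] that by (simp add: hb cE)
    have mono: "h i \<le> h (i + 1)" if "1 \<le> i" "2 * i \<le> d" for i
      using card_box_mono[of i] that by (simp add: hb cE)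
    show ?thesis
    \<comment> \<open>\<open>h 0 = 1\<close> is at most the nonzero \<open>h 1\<close>, and the
      entries 1 to \<open>d\<close> are symmetric, so the middle index is a peak.\<close>
    proof (rule unimodal_uptoI[of "(d + 1) div 2"])
      show "h i \<le> h (i + 1)" if "i < (d + 1) div 2" for i
        using that mono[of i] h0 h1 False by (cases "i = 0") auto
      show "h (i + 1) \<le> h i" if i: "(d + 1) div 2 \<le> i" "i < d" for i
      proof -
        \<comment> \<open>The descent from \<open>i\<close> to \<open>i + 1\<close> mirrors the
          ascent from \<open>d - i\<close> to \<open>d - i + 1\<close>.\<close>
        have "h (d - i) \<le> h (d - i + 1)" using i by (intro mono) auto
        moreover have "h (d - i) = h (i + 1)" using sym[of "i + 1"] i by simp
        moreover have "h (d - i + 1) = h i" using sym[of i] i assms(4) by (simp add: Suc_diff_le)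
        ultimately show ?thesis by simp
      qed
    qed (use assms(4) in simp)
  qed
  then show "unimodal_upto d (hstar_coeff M P)" by (simp add: h_def)
qed

end
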